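(* Let $n\ge 4$, $r_1,\ldots,r_n\ge 2$ integers, $t\in[n]$, and $s=n-1$. The ideal $I^{\langle n-1,t\rangle}$ of $R$ has exactly two minimal primes: the ideal $\widetilde{I}^{\langle n-1,t\rangle}$ and the monomial prime $P=\big(x_a : a\in\mathcal{N},\ (a_1,\ldots,a_{n-1})\ne(1,\ldots,1),(r_1,\ldots,r_{n-1})\big)$.
   Context: Notation: $[r]=\{1,\ldots,r\}$, $\mathcal{N}=[r_1]\times\cdots\times[r_n]$, $\Bbbk$ is an arbitrary field. $R=\Bbbk[x_a: a\in\mathcal{N}]$ is the polynomial ring where the variables are identified by $x_a=x_b$ if and only if $a,b$ are $(n-1)$-equivalent, i.e. $\sum_{i=1}^{n-1} a_i=\sum_{i=1}^{n-1} b_i$ and $a_n=b_n$ (so variables correspond bijectively to equivalence classes). For $i\in[n]$ and $a,b\in\mathcal{N}$, $\mathrm{sw}(i,a,b)\in\mathcal{N}$ is obtained from $a$ by replacing its $i$-th component by $b_i$; $f_{i,a,b}=x_ax_b-x_{\mathrm{sw}(i,a,b)}x_{\mathrm{sw}(i,b,a)}$; $\mathrm{d}(a,b)=\#\{i\in[n]: a_i\ne b_i\}$. The ideals are $I^{\langle n-1,t\rangle}=(f_{i,a,b}: a,b\in\mathcal{N},\ \mathrm{d}(a,b)=2,\ i\in[t])$ and $\widetilde{I}^{\langle n-1,t\rangle}=(f_{i,a,b}: a,b\in\mathcal{N},\ i\in[t])$. *)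

theory Defs
  imports "HOL-Library.Poly_Mapping" "HOL-Algebra.Ideal"
begin

text \<open>
  A monomial is a finitely supported exponent function \<open>'v \<Rightarrow>\<^sub>0 nat\<close> and a polynomial is a
  finitely supported function from monomials to coefficients, with the convolution product of
  \<^theory>\<open>HOL-Library.Poly_Mapping\<close>. The carrier is cut down so that the variables are exactly
  those in \<open>V\<close>, not all elements of the type \<open>'v\<close>.
\<close>

definition poly_ring :: "'v set \<Rightarrow> (('v \<Rightarrow>\<^sub>0 nat) \<Rightarrow>\<^sub>0 'k::comm_ring_1) ring" where
  "poly_ring V = \<lparr>carrier = {p. \<forall>m \<in> Poly_Mapping.keys p. Poly_Mapping.keys m \<subseteq> V},
                 monoid.mult = (*), one = 1, ring.zero = 0, add = (+)\<rparr>"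

definition poly_var :: "'v \<Rightarrow> (('v \<Rightarrow>\<^sub>0 nat) \<Rightarrow>\<^sub>0 'k::comm_ring_1)" where
  "poly_var v = Poly_Mapping.single (Poly_Mapping.single v 1) 1"

definition minimal_primes :: "('a, 'b) ring_scheme \<Rightarrow> 'a set \<Rightarrow> 'a set set" where
  "minimal_primes R I =
     {p. primeideal p R \<and> I \<subseteq> p \<and> (\<forall>q. primeideal q R \<and> I \<subseteq> q \<and> q \<subseteq> p \<longrightarrow> q = p)}"

text \<open>
  Multi-indices are 1-based tuples \<open>a 1, \<dots>, a n\<close>; extensionality (\<open>a i = undefined\<close> for
  \<open>i\<close> outside \<open>{1..n}\<close>) makes a tuple the same thing as its list of components.
\<close>

definition index_set :: "nat \<Rightarrow> (nat \<Rightarrow> nat) \<Rightarrow> (nat \<Rightarrow> nat) set" where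
  "index_set n r = (\<Pi>\<^sub>E i\<in>{1..n}. {1..r i})"

definition sw :: "nat \<Rightarrow> (nat \<Rightarrow> nat) \<Rightarrow> (nat \<Rightarrow> nat) \<Rightarrow> nat \<Rightarrow> nat" where
  "sw i a b = a(i := b i)"

definition hdist :: "nat \<Rightarrow> (nat \<Rightarrow> nat) \<Rightarrow> (nat \<Rightarrow> nat) \<Rightarrow> nat" where
  "hdist n a b = card {i \<in> {1..n}. a i \<noteq> b i}"

definition equivalent :: "nat \<Rightarrow> (nat \<Rightarrow> nat) \<Rightarrow> (nat \<Rightarrow> nat) \<Rightarrow> bool" where
  "equivalent n a b \<longleftrightarrow> (\<Sum>i=1..n-1. a i) = (\<Sum>i=1..n-1. b i) \<and> a n = b n"

text \<open>
  The \<open>(n-1)\<close>-equivalence class of \<open>a\<close> is encoded by the pair of invariants that defines it, so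
  that \<open>xvar n a = xvar n b\<close> if and only if \<open>a\<close> and \<open>b\<close> are equivalent (lemma \<open>xvar_eq_iff\<close>).
\<close>

definition key_of :: "nat \<Rightarrow> (nat \<Rightarrow> nat) \<Rightarrow> nat \<times> nat" where
  "key_of n a = ((\<Sum>i=1..n-1. a i), a n)"

type_synonym 'k pol = "(nat \<times> nat \<Rightarrow>\<^sub>0 nat) \<Rightarrow>\<^sub>0 'k"

definition idx_ring :: "nat \<Rightarrow> (nat \<Rightarrow> nat) \<Rightarrow> 'k::field pol ring" where
  "idx_ring n r = poly_ring (key_of n ` index_set n r)"

definition xvar :: "nat \<Rightarrow> (nat \<Rightarrow> nat) \<Rightarrow> 'k::field pol" where
  "xvar n a = poly_var (key_of n a)"

definition fgen :: "nat \<Rightarrow> nat \<Rightarrow> (nat \<Rightarrow> nat) \<Rightarrow> (nat \<Rightarrow> nat) \<Rightarrow> 'k::field pol" where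
  "fgen n i a b = xvar n a * xvar n b - xvar n (sw i a b) * xvar n (sw i b a)"

definition I_ideal :: "nat \<Rightarrow> (nat \<Rightarrow> nat) \<Rightarrow> nat \<Rightarrow> 'k::field pol set" where
  "I_ideal n r t = Idl\<^bsub>idx_ring n r\<^esub>
     {fgen n i a b | i a b. a \<in> index_set n r \<and> b \<in> index_set n r \<and> hdist n a b = 2 \<and> i \<in> {1..t}}"

definition I_tilde :: "nat \<Rightarrow> (nat \<Rightarrow> nat) \<Rightarrow> nat \<Rightarrow> 'k::field pol set" where
  "I_tilde n r t = Idl\<^bsub>idx_ring n r\<^esub>
     {fgen n i a b | i a b. a \<in> index_set n r \<and> b \<in> index_set n r \<and> i \<in> {1..t}}"

definition P_ideal :: "nat \<Rightarrow> (nat \<Rightarrow> nat) \<Rightarrow> 'k::field pol set" where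
  "P_ideal n r = Idl\<^bsub>idx_ring n r\<^esub>
     {xvar n a | a. a \<in> index_set n r \<and> \<not> (\<forall>i\<in>{1..n-1}. a i = 1) \<and> \<not> (\<forall>i\<in>{1..n-1}. a i = r i)}"

lemma xvar_eq_iff: "(xvar n a :: 'k::field pol) = xvar n b \<longleftrightarrow> equivalent n a b"
proof -
  have "(xvar n a :: 'k pol) = xvar n b \<longleftrightarrow> key_of n a = key_of n b"
  proof
    assume "(xvar n a :: 'k pol) = xvar n b"
    hence "Poly_Mapping.keys (xvar n a :: 'k pol) = Poly_Mapping.keys (xvar n b :: 'k pol)" by simp
    hence "Poly_Mapping.single (key_of n a) (1::nat) = Poly_Mapping.single (key_of n b) 1"
      by (simp add: xvar_def poly_var_def)
    hence "Poly_Mapping.keys (Poly_Mapping.single (key_of n a) (1::nat))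
         = Poly_Mapping.keys (Poly_Mapping.single (key_of n b) (1::nat))" by simp
    thus "key_of n a = key_of n b" by simp
  qed (simp add: xvar_def)
  thus ?thesis by (simp add: key_of_def equivalent_def)
qed

lemma poly_ring_cring: "cring (poly_ring V :: (('v \<Rightarrow>\<^sub>0 nat) \<Rightarrow>\<^sub>0 'k::comm_ring_1) ring)"
proof -
  define S :: "(('v \<Rightarrow>\<^sub>0 nat) \<Rightarrow>\<^sub>0 'k) ring" where "S = poly_ring V"
  define C where "C = carrier S"
  have ops: "add S = (+)" "monoid.mult S = (*)" "one S = 1" "ring.zero S = 0"
    by (simp_all add: S_def poly_ring_def)
  have C_iff: "p \<in> C \<longleftrightarrow> (\<forall>m \<in> Poly_Mapping.keys p. Poly_Mapping.keys m \<subseteq> V)" for p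
    by (simp add: C_def S_def poly_ring_def)
  have add: "p + q \<in> C" if "p \<in> C" "q \<in> C" for p q
    using that keys_add[of p q] unfolding C_iff by blast
  have mult: "p * q \<in> C" if "p \<in> C" "q \<in> C" for p q
    unfolding C_iff
  proof
    fix m assume "m \<in> Poly_Mapping.keys (p * q)"
    then obtain u v where "m = u + v" "u \<in> Poly_Mapping.keys p" "v \<in> Poly_Mapping.keys q"
      using keys_mult[of p q] by blast
    moreover from this have "Poly_Mapping.keys u \<subseteq> V" "Poly_Mapping.keys v \<subseteq> V"
      using that unfolding C_iff by blast+
    ultimately show "Poly_Mapping.keys m \<subseteq> V"
      using keys_add[of u v] by blast
  qed
  have zero: "0 \<in> C" and one: "1 \<in> C"
    unfolding C_iff by simp_all
  have uminus: "- p \<in> C" if "p \<in> C" for p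
    using that unfolding C_iff by (simp add: in_keys_iff)
  have "abelian_group S"
  proof (rule abelian_groupI; unfold ops C_def[symmetric])
    fix p assume "p \<in> C"
    thus "\<exists>q\<in>C. q + p = 0"
      by (intro bexI[of _ "- p"] uminus) simp_all
  qed (auto intro: add zero simp: add.assoc add.commute)
  moreover have "Group.comm_monoid S"
    by (rule comm_monoidI; unfold ops C_def[symmetric])
       (auto intro: mult one simp: mult.assoc mult.commute)
  ultimately show ?thesis
    unfolding S_def[symmetric] by (rule cringI) (simp add: ops distrib_right)
qed

lemma sw_in_index_set:
  assumes "a \<in> index_set n r" "b \<in> index_set n r" "i \<in> {1..n}"
  shows "sw i a b \<in> index_set n r"
  using assms by (auto simp: sw_def index_set_def PiE_iff extensional_def)

lemma xvar_in_carrier: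
  assumes "a \<in> index_set n r"
  shows "(xvar n a :: 'k::field pol) \<in> carrier (idx_ring n r)"
  using assms by (simp add: xvar_def poly_var_def idx_ring_def poly_ring_def)

lemma fgen_in_carrier:
  assumes "a \<in> index_set n r" "b \<in> index_set n r" "i \<in> {1..n}"
  shows "(fgen n i a b :: 'k::field pol) \<in> carrier (idx_ring n r)"
proof -
  interpret cring "idx_ring n r :: 'k pol ring"
    unfolding idx_ring_def by (rule poly_ring_cring)
  have mult: "p * q \<in> carrier (idx_ring n r)"
    if "p \<in> carrier (idx_ring n r)" "q \<in> carrier (idx_ring n r)" for p q :: "'k pol"
    using m_closed[OF that] by (simp add: idx_ring_def poly_ring_def)
  have diff: "p - q \<in> carrier (idx_ring n r)"
    if "p \<in> carrier (idx_ring n r)" "q \<in> carrier (idx_ring n r)" for p q :: "'k pol"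
    using that keys_diff[of p q] unfolding idx_ring_def poly_ring_def by auto
  show ?thesis
    unfolding fgen_def using assms
    by (intro diff mult xvar_in_carrier sw_in_index_set)
qed

end

theory Submission
  imports Defs "HOL-Library.Product_Lexorder" "HOL-Library.Multiset"
begin

text \<open>
  The variables are indexed by pairs \<open>(s, k)\<close>, where \<open>s\<close> runs over an interval
  from \<open>n - 1\<close> to the maximal prefix sum and \<open>k\<close> over the last components.
  Write \<open>x\<^bsub>(s,k)\<^esub>\<close> for them.

  The ideal \<open>I_tilde\<close> is the kernel of the substitution
  \<open>x\<^bsub>(s,k)\<^esub> \<mapsto> u\<^sup>s z\<^sub>k\<close> into an integral domain and therefore
  prime. A swap does not change the image of a product of two variables, so
  \<open>I_tilde\<close> lies in the kernel; conversely it contains all unit exchanges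
  \<open>x\<^bsub>(s,k)\<^esub> x\<^bsub>(s',k')\<^esub> - x\<^bsub>(s+1,k)\<^esub> x\<^bsub>(s'-1,k')\<^esub>\<close>
  (\<open>exchange_mem_I_tilde\<close>), and these connect any two monomials with the same image
  (\<open>eq_toric_kernel\<close>). The ideal \<open>P_ideal\<close> is generated by the variables with
  \<open>s\<close> in the interior of the interval, so it is prime too. It contains \<open>I_ideal\<close>
  because two tuples at distance \<open>2\<close> cannot both have an extreme prefix once
  \<open>n \<ge> 4\<close> (\<open>key_inner_if_hdist_2\<close>). Neither of the two primes contains the
  other.

  It remains to see that a prime \<open>q\<close> over \<open>I_ideal\<close> contains one of them. The
  generators with distance \<open>2\<close> include
  \<open>x\<^bsub>(s,k)\<^esub> x\<^bsub>(s+2,k)\<^esub> - x\<^bsub>(s+1,k)\<^esub>\<^sup>2\<close> and the minors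
  \<open>x\<^bsub>(s,k)\<^esub> x\<^bsub>(s+1,k')\<^esub> - x\<^bsub>(s+1,k)\<^esub> x\<^bsub>(s,k')\<^esub>\<close>, already for
  swaps of the first component. If \<open>q\<close> misses one interior variable of some column
  \<open>k\<close>, the first relations make that whole column nonzero and a geometric progression
  in the fraction field of the residue domain; the minors force the same ratio on all columns. Then
  all the binomials of \<open>I_tilde\<close> vanish modulo \<open>q\<close>
  (\<open>scroll_relation_mem\<close>).
\<close>

section \<open>Ideals of a polynomial ring\<close>

lemma poly_ring_simps [simp]:
  "monoid.mult (poly_ring V) = (*)" "one (poly_ring V) = 1"
  "ring.zero (poly_ring V) = 0" "add (poly_ring V) = (+)"
  by (simp_all add: poly_ring_def)

lemma carrier_poly_ring_iff:
  "p \<in> carrier (poly_ring V) \<longleftrightarrow> (\<forall>m \<in> Poly_Mapping.keys p. Poly_Mapping.keys m \<subseteq> V)"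
  by (simp add: poly_ring_def)

lemma poly_ring_closed:
  fixes p q :: "('v \<Rightarrow>\<^sub>0 nat) \<Rightarrow>\<^sub>0 'k::comm_ring_1"
  assumes "p \<in> carrier (poly_ring V)" "q \<in> carrier (poly_ring V)"
  shows "p + q \<in> carrier (poly_ring V)" "p * q \<in> carrier (poly_ring V)"
    "p - q \<in> carrier (poly_ring V)"
proof -
  interpret cring "poly_ring V :: (('v \<Rightarrow>\<^sub>0 nat) \<Rightarrow>\<^sub>0 'k) ring" by (rule poly_ring_cring)
  show "p + q \<in> carrier (poly_ring V)" "p * q \<in> carrier (poly_ring V)"
    using a_closed[OF assms] m_closed[OF assms] by simp_all
  show "p - q \<in> carrier (poly_ring V)"
    using assms keys_diff[of p q] by (auto simp: carrier_poly_ring_iff)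
qed

lemma poly_ring_consts:
  "0 \<in> carrier (poly_ring V)" "1 \<in> carrier (poly_ring V)"
  "- 1 \<in> carrier (poly_ring V :: (('v \<Rightarrow>\<^sub>0 nat) \<Rightarrow>\<^sub>0 'k::comm_ring_1) ring)"
  by (simp_all add: carrier_poly_ring_iff)

lemma poly_ring_power_closed:
  "p \<in> carrier (poly_ring V) \<Longrightarrow> p ^ k \<in> carrier (poly_ring V)"
  by (induction k) (auto intro: poly_ring_closed poly_ring_consts)

lemma poly_ring_prod_closed:
  "(\<And>i. i \<in> A \<Longrightarrow> f i \<in> carrier (poly_ring V)) \<Longrightarrow> prod f A \<in> carrier (poly_ring V)"
  by (induction A rule: infinite_finite_induct) (auto intro: poly_ring_closed poly_ring_consts)

lemma single_in_poly_ring: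
  "Poly_Mapping.keys m \<subseteq> V \<Longrightarrow> Poly_Mapping.single m c \<in> carrier (poly_ring V)"
  by (simp add: carrier_poly_ring_iff)

lemma poly_var_in_poly_ring: "v \<in> V \<Longrightarrow> poly_var v \<in> carrier (poly_ring V)"
  by (simp add: poly_var_def single_in_poly_ring)

lemma keys_add_nat:
  "Poly_Mapping.keys (u + v :: 'a \<Rightarrow>\<^sub>0 nat) = Poly_Mapping.keys u \<union> Poly_Mapping.keys v"
  by (auto simp: in_keys_iff lookup_add)

text \<open>
  The operations of the ring record are those of the type, so ideals and primes are characterised by
  closure conditions in which ordinary ring arithmetic (and its simplification rules) can be used.
\<close>

lemma ideal_poly_ring_iff:
  fixes J :: "(('v \<Rightarrow>\<^sub>0 nat) \<Rightarrow>\<^sub>0 'k::comm_ring_1) set"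
  shows "ideal J (poly_ring V) \<longleftrightarrow>
    J \<subseteq> carrier (poly_ring V) \<and> 0 \<in> J \<and> (\<forall>x\<in>J. \<forall>y\<in>J. x + y \<in> J) \<and>
    (\<forall>c\<in>carrier (poly_ring V). \<forall>x\<in>J. c * x \<in> J)" (is "?L \<longleftrightarrow> ?R")
proof
  assume ?L
  then interpret ideal J "poly_ring V" .
  show ?R
    using a_subset additive_subgroup.zero_closed[OF is_additive_subgroup]
      additive_subgroup.a_closed[OF is_additive_subgroup] I_l_closed by simp
next
  assume R: ?R
  interpret cring "poly_ring V :: (('v \<Rightarrow>\<^sub>0 nat) \<Rightarrow>\<^sub>0 'k) ring" by (rule poly_ring_cring)
  show ?L
  proof (rule idealI)
    show "ring (poly_ring V)" by (rule cring.axioms(1)[OF poly_ring_cring])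
    have neg: "\<ominus>\<^bsub>poly_ring V\<^esub> x = - x" if "x \<in> J" for x
    proof (rule minus_equality)
      show "- x \<in> carrier (poly_ring V)" "x \<in> carrier (poly_ring V)"
        using that R poly_ring_consts(3)[of V] by force+
    qed simp
    have "- x \<in> J" if "x \<in> J" for x
      using that R poly_ring_consts(3)[of V] by force
    then show "subgroup J (add_monoid (poly_ring V))"
      using R neg[unfolded a_inv_def] by (intro subgroup.intro) auto
    fix a x :: "('v \<Rightarrow>\<^sub>0 nat) \<Rightarrow>\<^sub>0 'k"
    assume "a \<in> J" "x \<in> carrier (poly_ring V)"
    then have "x * a \<in> J" using R by blast
    then show "x \<otimes>\<^bsub>poly_ring V\<^esub> a \<in> J" "a \<otimes>\<^bsub>poly_ring V\<^esub> x \<in> J"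
      by (simp_all add: mult.commute)
  qed
qed

lemma primeideal_poly_ring_iff:
  fixes J :: "(('v \<Rightarrow>\<^sub>0 nat) \<Rightarrow>\<^sub>0 'k::comm_ring_1) set"
  shows "primeideal J (poly_ring V) \<longleftrightarrow>
    ideal J (poly_ring V) \<and> 1 \<notin> J \<and>
    (\<forall>x\<in>carrier (poly_ring V). \<forall>y\<in>carrier (poly_ring V). x * y \<in> J \<longrightarrow> x \<in> J \<or> y \<in> J)"
    (is "?L \<longleftrightarrow> ?R")
proof
  assume ?L
  then interpret primeideal J "poly_ring V" .
  show ?R
    using ideal_axioms I_prime I_notcarr one_imp_carrier by simp blast
next
  assume R: ?R
  show ?L
    using R poly_ring_consts(2)[of V]
    by (intro primeideal.intro primeideal_axioms.intro poly_ring_cring) (simp_all, blast+)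
qed

text \<open>
  Congruence modulo the ideal is written \<open>x - y \<in> J\<close> throughout.
\<close>

locale poly_ideal =
  fixes V :: "'v set" and J :: "(('v \<Rightarrow>\<^sub>0 nat) \<Rightarrow>\<^sub>0 'k::comm_ring_1) set"
  assumes ideal: "ideal J (poly_ring V)"
begin

abbreviation C where "C \<equiv> carrier (poly_ring V :: (('v \<Rightarrow>\<^sub>0 nat) \<Rightarrow>\<^sub>0 'k) ring)"

lemma
  shows subset: "J \<subseteq> C" and zero_mem: "0 \<in> J"
    and add_mem: "x \<in> J \<Longrightarrow> y \<in> J \<Longrightarrow> x + y \<in> J"
    and mult_mem: "c \<in> C \<Longrightarrow> x \<in> J \<Longrightarrow> c * x \<in> J"
  using ideal unfolding ideal_poly_ring_iff by blast+

lemma diff_mem: "x \<in> J \<Longrightarrow> y \<in> J \<Longrightarrow> x - y \<in> J"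
  using add_mem[of x "- 1 * y"] mult_mem[OF poly_ring_consts(3), of y] by simp

lemma diff_mem_trans: "x - y \<in> J \<Longrightarrow> y - z \<in> J \<Longrightarrow> x - z \<in> J"
  using add_mem[of "x - y" "y - z"] by simp

lemma sum_mem: "(\<And>i. i \<in> A \<Longrightarrow> f i \<in> J) \<Longrightarrow> sum f A \<in> J"
  by (induction A rule: infinite_finite_induct) (auto intro: add_mem zero_mem)

end

locale poly_prime = poly_ideal V J
  for V :: "'v set" and J :: "(('v \<Rightarrow>\<^sub>0 nat) \<Rightarrow>\<^sub>0 'k::comm_ring_1) set" +
  assumes prime: "primeideal J (poly_ring V)"
begin

lemma cancel: "c * x \<in> J \<Longrightarrow> c \<notin> J \<Longrightarrow> c \<in> C \<Longrightarrow> x \<in> C \<Longrightarrow> x \<in> J"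
  using prime unfolding primeideal_poly_ring_iff by blast

lemma power_not_mem: "c \<in> C \<Longrightarrow> c \<notin> J \<Longrightarrow> c ^ k \<notin> J"
proof (induction k)
  case 0
  then show ?case using prime unfolding primeideal_poly_ring_iff by simp
next
  case (Suc k)
  then show ?case
    using cancel[of c "c ^ k"] poly_ring_power_closed[of c V k] by auto
qed

end

section \<open>Minimal primes\<close>

lemma minimal_primes_eq_pair:
  assumes "primeideal A R" "primeideal B R" "I \<subseteq> A" "I \<subseteq> B" "\<not> A \<subseteq> B" "\<not> B \<subseteq> A"
    and "\<And>q. primeideal q R \<Longrightarrow> I \<subseteq> q \<Longrightarrow> A \<subseteq> q \<or> B \<subseteq> q"
  shows "minimal_primes R I = {A, B}"
proof (rule Set.set_eqI)
  fix p
  have "q = p" if "p = A \<or> p = B" "primeideal q R" "I \<subseteq> q" "q \<subseteq> p" for q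
    using that(1,4) assms(5,6) assms(7)[OF that(2,3)] by blast
  then have "p \<in> minimal_primes R I" if "p = A \<or> p = B"
    using that assms(1-4) unfolding minimal_primes_def by auto
  moreover have "p = A \<or> p = B" if "p \<in> minimal_primes R I"
  proof -
    from that have p: "primeideal p R" "I \<subseteq> p"
      and min: "\<And>q. primeideal q R \<Longrightarrow> I \<subseteq> q \<Longrightarrow> q \<subseteq> p \<Longrightarrow> q = p"
      unfolding minimal_primes_def by auto
    show ?thesis using assms(7)[OF p] min[OF assms(1,3)] min[OF assms(2,4)] by auto
  qed
  ultimately show "p \<in> minimal_primes R I \<longleftrightarrow> p \<in> {A, B}" by auto
qed

section \<open>Kernels of monomial maps\<close>

abbreviation (input) lookup where "lookup \<equiv> Poly_Mapping.lookup"

text \<open>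
  The linear extension of a map of exponents. If \<open>\<psi>\<close> is additive, this is the ring
  homomorphism that substitutes the monomial with exponent \<open>\<psi>\<close> of \<open>v\<close> for each
  variable \<open>v\<close>, so that its kernels are the toric ideals.
\<close>

definition monomial_map :: "('a \<Rightarrow> 'b) \<Rightarrow> ('a \<Rightarrow>\<^sub>0 'k) \<Rightarrow> ('b \<Rightarrow>\<^sub>0 'k::comm_ring_1)" where
  "monomial_map \<psi> p = (\<Sum>m\<in>Poly_Mapping.keys p. Poly_Mapping.single (\<psi> m) (lookup p m))"

lemma monomial_map_superset:
  assumes "finite A" "Poly_Mapping.keys p \<subseteq> A"
  shows "monomial_map \<psi> p = (\<Sum>m\<in>A. Poly_Mapping.single (\<psi> m) (lookup p m))"
  unfolding monomial_map_def
  by (rule sum.mono_neutral_left) (use assms in \<open>auto simp: in_keys_iff\<close>)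

lemma monomial_map_single [simp]:
  "monomial_map \<psi> (Poly_Mapping.single m c) = Poly_Mapping.single (\<psi> m) c"
  by (simp add: monomial_map_def)

lemma monomial_map_zero [simp]: "monomial_map \<psi> 0 = 0"
  by (simp add: monomial_map_def)

lemma monomial_map_add: "monomial_map \<psi> (p + q) = monomial_map \<psi> p + monomial_map \<psi> q"
proof -
  let ?A = "Poly_Mapping.keys p \<union> Poly_Mapping.keys q"
  show ?thesis
    using keys_add[of p q]
    by (simp add: monomial_map_superset[of ?A] lookup_add single_add sum.distrib)
qed

lemma monomial_map_sum: "monomial_map \<psi> (sum f A) = (\<Sum>i\<in>A. monomial_map \<psi> (f i))"
  by (induction A rule: infinite_finite_induct) (auto simp: monomial_map_add)

lemma poly_mapping_eq_sum_single:
  "p = (\<Sum>m\<in>Poly_Mapping.keys p. Poly_Mapping.single m (lookup p m))"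
  by (rule poly_mapping_eqI) (auto simp: lookup_sum lookup_single when_def in_keys_iff)

lemma monomial_map_mult:
  fixes \<psi> :: "'a::comm_monoid_add \<Rightarrow> 'b::comm_monoid_add"
  assumes "\<And>m m'. \<psi> (m + m') = \<psi> m + \<psi> m'"
  shows "monomial_map \<psi> (p * q) = monomial_map \<psi> p * monomial_map \<psi> q"
proof -
  have "p * q = (\<Sum>m\<in>Poly_Mapping.keys p. Poly_Mapping.single m (lookup p m))
      * (\<Sum>m\<in>Poly_Mapping.keys q. Poly_Mapping.single m (lookup q m))"
    by (rule arg_cong2[where f = "(*)", OF poly_mapping_eq_sum_single poly_mapping_eq_sum_single])
  then have "p * q = (\<Sum>m\<in>Poly_Mapping.keys p. \<Sum>m'\<in>Poly_Mapping.keys q.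
      Poly_Mapping.single (m + m') (lookup p m * lookup q m'))"
    by (simp add: sum_product mult_single)
  then have "monomial_map \<psi> (p * q) = (\<Sum>m\<in>Poly_Mapping.keys p. \<Sum>m'\<in>Poly_Mapping.keys q.
      Poly_Mapping.single (\<psi> m + \<psi> m') (lookup p m * lookup q m'))"
    by (simp add: monomial_map_sum assms)
  also have "\<dots> = monomial_map \<psi> p * monomial_map \<psi> q"
    unfolding monomial_map_def by (simp add: sum_product mult_single)
  finally show ?thesis .
qed

text \<open>
  The order on the target exponents makes the target polynomial ring an integral domain: leading
  terms multiply.
\<close>

lemma primeideal_kernel_monomial_map:
  fixes \<psi> :: "('v \<Rightarrow>\<^sub>0 nat) \<Rightarrow> 'b::{ordered_cancel_comm_monoid_add, linorder}"
  assumes "\<And>m m'. \<psi> (m + m') = \<psi> m + \<psi> m'"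
  shows "primeideal {p \<in> carrier (poly_ring V). monomial_map \<psi> p = (0 :: 'b \<Rightarrow>\<^sub>0 'k::idom)} (poly_ring V)"
  unfolding primeideal_poly_ring_iff ideal_poly_ring_iff
proof (intro conjI ballI impI)
  have "monomial_map \<psi> (Poly_Mapping.single 0 1 :: ('v \<Rightarrow>\<^sub>0 nat) \<Rightarrow>\<^sub>0 'k) \<noteq> 0"
    by (metis monomial_map_single keys_single keys_zero insert_not_empty zero_neq_one)
  then show "1 \<notin> {p \<in> carrier (poly_ring V). monomial_map \<psi> p = (0 :: 'b \<Rightarrow>\<^sub>0 'k)}" by simp
qed (simp_all add: monomial_map_add monomial_map_mult[OF assms] poly_ring_closed poly_ring_consts)

text \<open>
  An ideal inside the kernel is the whole kernel as soon as it identifies any two monomials with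
  the same image: modulo such an ideal, a polynomial can be rewritten with one chosen monomial per
  fibre of \<open>\<psi>\<close>, and its coefficients are then those of its image.
\<close>

lemma (in poly_ideal) eq_kernel_monomial_map:
  fixes \<psi> :: "('v \<Rightarrow>\<^sub>0 nat) \<Rightarrow> 'b"
  assumes ker: "\<And>p. p \<in> J \<Longrightarrow> monomial_map \<psi> p = 0"
    and fibre: "\<And>m m'. Poly_Mapping.keys m \<subseteq> V \<Longrightarrow> Poly_Mapping.keys m' \<subseteq> V \<Longrightarrow> \<psi> m = \<psi> m' \<Longrightarrow>
      Poly_Mapping.single m 1 - Poly_Mapping.single m' 1 \<in> J"
  shows "J = {p \<in> C. monomial_map \<psi> p = 0}"
proof
  show "J \<subseteq> {p \<in> C. monomial_map \<psi> p = 0}" using subset ker by blast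
  show "{p \<in> C. monomial_map \<psi> p = 0} \<subseteq> J"
  proof clarify
    fix p assume p: "p \<in> C" "monomial_map \<psi> p = 0"
    \<comment> \<open>one chosen monomial of \<open>p\<close> in each fibre of \<open>\<psi>\<close>\<close>
    define N where "N w = (SOME m. m \<in> Poly_Mapping.keys p \<and> \<psi> m = w)" for w
    have N: "N (\<psi> m) \<in> Poly_Mapping.keys p \<and> \<psi> (N (\<psi> m)) = \<psi> m" if "m \<in> Poly_Mapping.keys p" for m
      unfolding N_def by (rule someI[of _ m]) (use that in simp)
    have "monomial_map N (monomial_map \<psi> p) =
        (\<Sum>m\<in>Poly_Mapping.keys p. Poly_Mapping.single (N (\<psi> m)) (lookup p m))"
      unfolding monomial_map_def[of \<psi>] monomial_map_sum by simp
    with p(2) have "p = (\<Sum>m\<in>Poly_Mapping.keys p. Poly_Mapping.single m (lookup p m))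
        - (\<Sum>m\<in>Poly_Mapping.keys p. Poly_Mapping.single (N (\<psi> m)) (lookup p m))"
      by (metis (no_types) diff_zero monomial_map_zero poly_mapping_eq_sum_single)
    also have "\<dots> = (\<Sum>m\<in>Poly_Mapping.keys p. Poly_Mapping.single 0 (lookup p m) *
        (Poly_Mapping.single m 1 - Poly_Mapping.single (N (\<psi> m)) 1))"
      by (simp add: sum_subtractf right_diff_distrib mult_single)
    also have "\<dots> \<in> J"
      using N p(1) by (intro sum_mem mult_mem fibre) (auto simp: carrier_poly_ring_iff)
    finally show "p \<in> J" .
  qed
qed

section \<open>Ideals generated by variables\<close>

lemma monomial_ideal_eq:
  fixes V W :: "'v set"
  assumes "W \<subseteq> V"
  shows "Idl\<^bsub>poly_ring V\<^esub> (poly_var ` W) =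
    {p \<in> carrier (poly_ring V :: (('v \<Rightarrow>\<^sub>0 nat) \<Rightarrow>\<^sub>0 'k::comm_ring_1) ring).
       \<forall>m\<in>Poly_Mapping.keys p. Poly_Mapping.keys m \<inter> W \<noteq> {}}" (is "?I = ?M")
proof
  interpret R: cring "poly_ring V :: (('v \<Rightarrow>\<^sub>0 nat) \<Rightarrow>\<^sub>0 'k) ring" by (rule poly_ring_cring)
  have W: "poly_var ` W \<subseteq> carrier (poly_ring V :: (('v \<Rightarrow>\<^sub>0 nat) \<Rightarrow>\<^sub>0 'k) ring)"
    using assms by (auto intro: poly_var_in_poly_ring)
  have "ideal ?M (poly_ring V)"
    unfolding ideal_poly_ring_iff
  proof (intro conjI ballI)
    fix x y assume "x \<in> ?M" "y \<in> ?M"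
    then show "x + y \<in> ?M" using keys_add[of x y] by (auto intro: poly_ring_closed)
  next
    fix c x :: "('v \<Rightarrow>\<^sub>0 nat) \<Rightarrow>\<^sub>0 'k"
    assume c: "c \<in> carrier (poly_ring V)" and x: "x \<in> ?M"
    have "Poly_Mapping.keys m \<inter> W \<noteq> {}" if "m \<in> Poly_Mapping.keys (c * x)" for m
    proof -
      from that keys_mult[of c x] obtain u v where m: "m = u + v" "v \<in> Poly_Mapping.keys x" by blast
      then obtain w where "w \<in> W" "lookup v w \<noteq> 0" using x by (fastforce simp: in_keys_iff)
      with m(1) show ?thesis using in_keys_iff[of w v] unfolding m(1) keys_add_nat by blast
    qed
    with c x show "c * x \<in> ?M" by (auto intro: poly_ring_closed)
  qed (auto intro: poly_ring_consts)
  moreover have "poly_var ` W \<subseteq> ?M" using W by (auto simp: poly_var_def)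
  ultimately show "?I \<subseteq> ?M" by (rule R.genideal_minimal)
  interpret I: poly_ideal V ?I by (rule poly_ideal.intro[OF R.genideal_ideal[OF W]])
  show "?M \<subseteq> ?I"
  proof
    fix p assume p: "p \<in> ?M"
    have "Poly_Mapping.single m (lookup p m) \<in> ?I" if m: "m \<in> Poly_Mapping.keys p" for m
    proof -
      from p m obtain w where w: "w \<in> W" "lookup m w \<noteq> 0" by (fastforce simp: in_keys_iff)
      define u where "u = m - Poly_Mapping.single w 1"
      have mu: "m = u + Poly_Mapping.single w 1"
        using w(2) unfolding u_def
        by (intro poly_mapping_eqI) (auto simp: lookup_add lookup_minus lookup_single when_def)
      have "Poly_Mapping.keys u \<subseteq> Poly_Mapping.keys m"
        unfolding mu by (auto simp: in_keys_iff lookup_add)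
      then have "Poly_Mapping.single u (lookup p m) * poly_var w \<in> ?I"
        using p m w(1) R.genideal_self[OF W]
        by (intro I.mult_mem single_in_poly_ring) (auto simp: carrier_poly_ring_iff)
      moreover have "Poly_Mapping.single u (lookup p m) * poly_var w
          = Poly_Mapping.single m (lookup p m)"
        using mu by (simp add: poly_var_def mult_single)
      ultimately show ?thesis by simp
    qed
    then show "p \<in> ?I"
      by (subst poly_mapping_eq_sum_single[of p]) (rule I.sum_mem)
  qed
qed

text \<open>
  Modulo the ideal every polynomial is represented by its part free of the variables in
  \<open>W\<close>. Products of such parts stay free of \<open>W\<close>, so a product in the ideal
  has a free part equal to \<open>0\<close>, and so one of the two free parts vanishes because the
  polynomials form an integral domain. The order on the variables gives the monomials the linear
  order by which leading terms are compared there.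
\<close>

lemma primeideal_monomial_ideal:
  fixes V W :: "'v::linorder set"
  assumes "W \<subseteq> V"
  shows "primeideal (Idl\<^bsub>poly_ring V\<^esub> (poly_var ` W))
    (poly_ring V :: (('v \<Rightarrow>\<^sub>0 nat) \<Rightarrow>\<^sub>0 'k::idom) ring)" (is "primeideal ?I _")
proof -
  interpret R: cring "poly_ring V :: (('v \<Rightarrow>\<^sub>0 nat) \<Rightarrow>\<^sub>0 'k) ring" by (rule poly_ring_cring)
  have W: "poly_var ` W \<subseteq> carrier (poly_ring V :: (('v \<Rightarrow>\<^sub>0 nat) \<Rightarrow>\<^sub>0 'k) ring)"
    using assms by (auto intro: poly_var_in_poly_ring)
  interpret I: poly_ideal V ?I by (rule poly_ideal.intro[OF R.genideal_ideal[OF W]])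
  define free where "free m \<longleftrightarrow> Poly_Mapping.keys m \<inter> W = {}" for m :: "'v \<Rightarrow>\<^sub>0 nat"
  have mem_iff: "p \<in> ?I \<longleftrightarrow> p \<in> I.C \<and> (\<forall>m\<in>Poly_Mapping.keys p. \<not> free m)"
    for p :: "('v \<Rightarrow>\<^sub>0 nat) \<Rightarrow>\<^sub>0 'k"
    by (auto simp: monomial_ideal_eq[OF assms] free_def)
  have split: "\<exists>p0. p0 \<in> I.C \<and> p - p0 \<in> ?I \<and> (\<forall>m\<in>Poly_Mapping.keys p0. free m)"
    if p: "p \<in> I.C" for p
  proof -
    define p0 where "p0 = (\<Sum>m\<in>{m\<in>Poly_Mapping.keys p. free m}. Poly_Mapping.single m (lookup p m))"
    have lookup_p0: "lookup p0 m = (if free m then lookup p m else 0)" for m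
      by (auto simp: p0_def lookup_sum lookup_single when_def in_keys_iff)
    have "p0 \<in> I.C" using p by (auto simp: carrier_poly_ring_iff in_keys_iff[of _ p] in_keys_iff[of _ p0] lookup_p0
      split: if_splits)
    moreover from this p have "p - p0 \<in> ?I"
      by (auto simp: mem_iff in_keys_iff lookup_p0 lookup_minus intro: poly_ring_closed)
    moreover have "\<forall>m\<in>Poly_Mapping.keys p0. free m"
      by (auto simp: in_keys_iff lookup_p0 split: if_splits)
    ultimately show ?thesis by blast
  qed
  show ?thesis
    unfolding primeideal_poly_ring_iff
  proof (intro conjI ballI impI I.ideal)
    show "1 \<notin> ?I" by (simp add: mem_iff free_def)
    fix p q assume p: "p \<in> I.C" and q: "q \<in> I.C" and pq: "p * q \<in> ?I"
    obtain p0 where p0: "p0 \<in> I.C" "p - p0 \<in> ?I" "\<forall>m\<in>Poly_Mapping.keys p0. free m"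
      using split[OF p] by blast
    obtain q0 where q0: "q0 \<in> I.C" "q - q0 \<in> ?I" "\<forall>m\<in>Poly_Mapping.keys q0. free m"
      using split[OF q] by blast
    have "p * q - (q * (p - p0) + p0 * (q - q0)) \<in> ?I"
      using I.diff_mem[OF pq I.add_mem[OF I.mult_mem[OF q p0(2)] I.mult_mem[OF p0(1) q0(2)]]] .
    then have "p0 * q0 \<in> ?I" by (simp add: algebra_simps)
    moreover have "free m" if "m \<in> Poly_Mapping.keys (p0 * q0)" for m
    proof -
      from that keys_mult[of p0 q0] obtain u v
        where "m = u + v" "u \<in> Poly_Mapping.keys p0" "v \<in> Poly_Mapping.keys q0" by blast
      with p0(3) q0(3) keys_add[of u v] show ?thesis unfolding free_def by blast
    qed
    ultimately have "Poly_Mapping.keys (p0 * q0) = {}" unfolding mem_iff by blast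
    then have "p0 = 0 \<or> q0 = 0" by simp
    then show "p \<in> ?I \<or> q \<in> ?I" using p0(2) q0(2) by auto
  qed
qed

section \<open>The toric ideal of a rational normal scroll\<close>

text \<open>
  The exponents of the parametrisation \<open>x\<^bsub>(s,k)\<^esub> \<mapsto> u\<^sup>s z\<^sub>k\<close>,
  with index \<open>0\<close> for \<open>u\<close> and index \<open>Suc k\<close> for
  \<open>z\<^sub>k\<close>. Plain natural numbers index the target variables so that the target
  exponents are linearly ordered.
\<close>

definition weight :: "(nat \<times> nat \<Rightarrow>\<^sub>0 nat) \<Rightarrow> (nat \<Rightarrow>\<^sub>0 nat)" where
  "weight m = (\<Sum>v\<in>Poly_Mapping.keys m.
     Poly_Mapping.single 0 (lookup m v * fst v) + Poly_Mapping.single (Suc (snd v)) (lookup m v))"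

lemma weight_add: "weight (m + m') = weight m + weight m'"
proof -
  let ?f = "\<lambda>m v. Poly_Mapping.single 0 (lookup m v * fst v) + Poly_Mapping.single (Suc (snd v)) (lookup m v)"
  have sup: "weight m = (\<Sum>v\<in>A. ?f m v)" if "finite A" "Poly_Mapping.keys m \<subseteq> A" for m A
    unfolding weight_def
    by (rule sum.mono_neutral_left) (use that in \<open>auto simp: in_keys_iff\<close>)
  let ?A = "Poly_Mapping.keys m \<union> Poly_Mapping.keys m'"
  show ?thesis
    by (simp add: sup[of ?A] keys_add_nat lookup_add single_add distrib_right sum.distrib
        add.assoc add.commute add.left_commute)
qed

lemma weight_0 [simp]: "weight 0 = 0"
  by (simp add: weight_def)

lemma weight_single:
  "weight (Poly_Mapping.single v 1) = Poly_Mapping.single 0 (fst v) + Poly_Mapping.single (Suc (snd v)) 1"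
  by (simp add: weight_def)

abbreviation monomial_of_list :: "'v list \<Rightarrow> 'v \<Rightarrow>\<^sub>0 nat" where
  "monomial_of_list xs \<equiv> (\<Sum>v\<leftarrow>xs. Poly_Mapping.single v 1)"

lemma exists_monomial_list: "\<exists>xs. set xs = Poly_Mapping.keys m \<and> m = monomial_of_list xs"
proof (induction m rule: update_induct)
  case const
  then show ?case by (intro exI[of _ "[]"]) simp
next
  case (update m a b)
  then obtain xs where xs: "set xs = Poly_Mapping.keys m" "m = monomial_of_list xs" by blast
  have rep: "monomial_of_list (replicate b a) = Poly_Mapping.single a b"
    by (induction b) (auto simp: single_add[symmetric])
  have "Poly_Mapping.update a b m = Poly_Mapping.single a b + m"
    using update(1) by (intro poly_mapping_eqI)
      (auto simp: lookup_update lookup_add lookup_single when_def in_keys_iff)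
  moreover have "set (replicate b a @ xs) = Poly_Mapping.keys (Poly_Mapping.single a b + m)"
    using update(2) xs(1) by (simp add: keys_add_nat)
  moreover have "Poly_Mapping.single a b + m = monomial_of_list (replicate b a @ xs)"
    using rep xs(2) by simp
  ultimately show ?case by metis
qed

lemma single_monomial_of_list:
  "Poly_Mapping.single (monomial_of_list xs) 1 =
    (prod_list (map poly_var xs) :: ('v \<Rightarrow>\<^sub>0 nat) \<Rightarrow>\<^sub>0 'k::comm_ring_1)"
proof (induction xs)
  case (Cons v xs)
  have "Poly_Mapping.single (monomial_of_list (v # xs)) (1 :: 'k) =
      poly_var v * Poly_Mapping.single (monomial_of_list xs) 1"
    by (simp add: poly_var_def mult_single)
  with Cons show ?case by simp
qed simp

lemma lookup_weight_monomial_of_list: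
  "lookup (weight (monomial_of_list xs)) 0 = sum_list (map fst xs)"
  "lookup (weight (monomial_of_list xs)) (Suc k) = count (mset (map snd xs)) k"
proof (induction xs)
  case (Cons v xs)
  case 1
  show ?case using Cons(1)
    by (simp add: weight_add weight_single[simplified] lookup_add lookup_single)
next
  case (Cons v xs)
  case 2
  show ?case using Cons(2)
    by (simp add: weight_add weight_single[simplified] lookup_add lookup_single when_def)
qed simp_all

lemma sum_fun_upd_add:
  fixes f :: "'a \<Rightarrow> 'b::comm_monoid_add"
  assumes "finite A" "i \<in> A"
  shows "sum (f(i := x)) A + f i = sum f A + x"
proof -
  have "sum (f(i := x)) (A - {i}) = sum f (A - {i})" by (rule sum.cong) auto
  then show ?thesis
    using sum.remove[OF assms, of f] sum.remove[OF assms, of "f(i := x)"] by (simp add: ac_simps)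
qed

text \<open>
  Two products with the same second indices \<open>k i\<close> and the same total of first indices
  are linked by unit exchanges: as long as the first indices differ, some \<open>s i\<close> is too
  large and some \<open>s l\<close> too small, and moving one unit from \<open>i\<close> to
  \<open>l\<close> decreases the total excess of \<open>s\<close> over \<open>s'\<close>. Both
  indices move towards values of \<open>s'\<close>, hence stay in the interval.
\<close>

lemma prod_exchange_mem:
  fixes J :: "((nat \<times> 'a \<Rightarrow>\<^sub>0 nat) \<Rightarrow>\<^sub>0 'k::comm_ring_1) set" and A :: "'b set"
  assumes J: "poly_ideal ({lo..hi} \<times> K) J"
    and exchange: "\<And>s s' k k'. s \<in> {lo..<hi} \<Longrightarrow> s' \<in> {lo<..hi} \<Longrightarrow> k \<in> K \<Longrightarrow> k' \<in> K \<Longrightarrow>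
      poly_var (s, k) * poly_var (s', k') - poly_var (Suc s, k) * poly_var (s' - 1, k') \<in> J"
    and A: "finite A" and k: "k \<in> A \<rightarrow> K"
    and "s \<in> A \<rightarrow> {lo..hi}" "s' \<in> A \<rightarrow> {lo..hi}" "sum s A = sum s' A"
  shows "(\<Prod>i\<in>A. poly_var (s i, k i)) - (\<Prod>i\<in>A. poly_var (s' i, k i)) \<in> J"
proof -
  interpret poly_ideal "{lo..hi} \<times> K" J by (fact J)
  show ?thesis
    using assms(5,7)
  proof (induction "\<Sum>i\<in>A. s i - s' i" arbitrary: s rule: less_induct)
    case less
    show ?case
    proof (cases "\<forall>i\<in>A. s i \<le> s' i")
      case True
      have "\<not> (\<exists>i\<in>A. s i < s' i)"
        using sum_strict_mono_ex1[OF A True] less.prems(2) by auto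
      with True have "s i = s' i" if "i \<in> A" for i
        using that by (meson le_neq_implies_less)
      then show ?thesis using zero_mem by simp
    next
      case False
      then obtain i where i: "i \<in> A" "s' i < s i" by force
      have "\<not> (\<forall>l\<in>A. s' l \<le> s l)"
        using sum_strict_mono_ex1[OF A, of s' s] i less.prems(2) by auto
      then obtain l where l: "l \<in> A" "s l < s' l" by (meson linorder_not_le)
      define u where "u = s(i := s i - 1, l := Suc (s l))"
      have il: "i \<noteq> l" using i l by auto
      have bounds: "s i \<in> {lo..hi}" "s l \<in> {lo..hi}" "s' i \<in> {lo..hi}" "s' l \<in> {lo..hi}"
        using i l less.prems(1) assms(6) by auto
      have u_range: "u \<in> A \<rightarrow> {lo..hi}"
        using less.prems(1) bounds i l unfolding u_def by (auto simp: Pi_iff)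
      have split: "prod f A = f l * f i * prod f (A - {l} - {i})" for f :: "'b \<Rightarrow> (nat \<times> 'a \<Rightarrow>\<^sub>0 nat) \<Rightarrow>\<^sub>0 'k"
        using A i l il by (simp add: prod.remove[of A l] prod.remove[of "A - {l}" i] mult.assoc)
      have "sum u A + s l = sum (s(i := s i - 1)) A + Suc (s l)"
        using sum_fun_upd_add[OF A l(1), of "s(i := s i - 1)" "Suc (s l)"] il unfolding u_def by simp
      moreover have "sum (s(i := s i - 1)) A + s i = sum s A + (s i - 1)"
        by (rule sum_fun_upd_add[OF A i(1)])
      ultimately have "sum u A = sum s' A" using less.prems(2) i(2) by linarith
      moreover have "(\<Sum>j\<in>A. u j - s' j) < (\<Sum>j\<in>A. s j - s' j)"
      proof (rule sum_strict_mono_ex1[OF A])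
        show "\<forall>j\<in>A. u j - s' j \<le> s j - s' j" using l(2) by (auto simp: u_def)
        show "\<exists>j\<in>A. u j - s' j < s j - s' j" using i il by (intro bexI[of _ i]) (auto simp: u_def)
      qed
      ultimately have "(\<Prod>i\<in>A. poly_var (u i, k i)) - (\<Prod>i\<in>A. poly_var (s' i, k i)) \<in> J"
        using less.hyps u_range by blast
      moreover have "(\<Prod>i\<in>A. poly_var (s i, k i)) - (\<Prod>i\<in>A. poly_var (u i, k i)) \<in> J"
      proof -
        let ?y = "\<lambda>s k. poly_var (s, k) :: (nat \<times> 'a \<Rightarrow>\<^sub>0 nat) \<Rightarrow>\<^sub>0 'k"
        let ?rest = "\<Prod>j\<in>A - {l} - {i}. ?y (s j) (k j)"
        have "(\<Prod>j\<in>A - {l} - {i}. ?y (u j) (k j)) = ?rest"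
          by (rule prod.cong) (auto simp: u_def)
        moreover have "u l = Suc (s l)" "u i = s i - 1" using il by (simp_all add: u_def)
        ultimately have "(\<Prod>j\<in>A. ?y (u j) (k j)) = ?y (Suc (s l)) (k l) * ?y (s i - 1) (k i) * ?rest"
          using split[of "\<lambda>j. ?y (u j) (k j)"] by simp
        moreover have "(\<Prod>j\<in>A. ?y (s j) (k j)) = ?y (s l) (k l) * ?y (s i) (k i) * ?rest"
          by (rule split)
        ultimately have "(\<Prod>j\<in>A. ?y (s j) (k j)) - (\<Prod>j\<in>A. ?y (u j) (k j)) = ?rest *
            (?y (s l) (k l) * ?y (s i) (k i) - ?y (Suc (s l)) (k l) * ?y (s i - 1) (k i))"
          by (simp only: algebra_simps)
        also have "\<dots> \<in> J"
          using bounds i l k less.prems(1)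
          by (intro mult_mem exchange poly_ring_prod_closed poly_var_in_poly_ring)
            (auto simp: Pi_iff)
        finally show ?thesis .
      qed
      ultimately show ?thesis using diff_mem_trans by blast
    qed
  qed
qed

lemma exists_monomial_list_sorted:
  fixes m :: "'a \<times> 'b::linorder \<Rightarrow>\<^sub>0 nat"
  shows "\<exists>xs. set xs = Poly_Mapping.keys m \<and> sorted (map snd xs) \<and> m = monomial_of_list xs"
proof -
  obtain xs where xs: "set xs = Poly_Mapping.keys m" "m = monomial_of_list xs"
    using exists_monomial_list[of m] by metis
  let ?ys = "sort_key snd xs"
  have "mset (map (\<lambda>v. Poly_Mapping.single v (1::nat)) ?ys) = mset (map (\<lambda>v. Poly_Mapping.single v 1) xs)"
    by simp
  then have "monomial_of_list ?ys = monomial_of_list xs"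
    unfolding sum_mset_sum_list[symmetric] by (rule arg_cong)
  with xs have "set ?ys = Poly_Mapping.keys m" "m = monomial_of_list ?ys" by (simp_all only: set_sort)
  then show ?thesis by (intro exI[of _ ?ys] conjI sorted_sort_key)
qed

text \<open>
  Equal weights mean equal totals of first indices and equal multisets of second indices. Listing
  the factors of both monomials by increasing second index aligns the second indices, which brings
  the two monomials into the form that unit exchanges connect.
\<close>

lemma eq_toric_kernel:
  fixes J :: "((nat \<times> nat \<Rightarrow>\<^sub>0 nat) \<Rightarrow>\<^sub>0 'k::comm_ring_1) set"
  assumes J: "poly_ideal ({lo..hi} \<times> K) J"
    and exchange: "\<And>s s' k k'. s \<in> {lo..<hi} \<Longrightarrow> s' \<in> {lo<..hi} \<Longrightarrow> k \<in> K \<Longrightarrow> k' \<in> K \<Longrightarrow>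
      poly_var (s, k) * poly_var (s', k') - poly_var (Suc s, k) * poly_var (s' - 1, k') \<in> J"
    and ker: "\<And>p. p \<in> J \<Longrightarrow> monomial_map weight p = 0"
  shows "J = {p \<in> carrier (poly_ring ({lo..hi} \<times> K)). monomial_map weight p = 0}"
proof (rule poly_ideal.eq_kernel_monomial_map[OF J ker])
  let ?V = "{lo..hi} \<times> K"
  fix m m' assume m: "Poly_Mapping.keys m \<subseteq> ?V" "Poly_Mapping.keys m' \<subseteq> ?V" "weight m = weight m'"
  obtain xs where xs: "set xs = Poly_Mapping.keys m" "sorted (map snd xs)" "m = monomial_of_list xs"
    using exists_monomial_list_sorted[of m] by metis
  obtain ys where ys: "set ys = Poly_Mapping.keys m'" "sorted (map snd ys)" "m' = monomial_of_list ys"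
    using exists_monomial_list_sorted[of m'] by metis
  have "mset (map snd xs) = mset (map snd ys)"
    using m(3) unfolding xs(3) ys(3)
    by (intro multiset_eqI) (metis lookup_weight_monomial_of_list(2))
  then have snd_eq: "map snd xs = map snd ys"
    using xs(2) ys(2) properties_for_sort[of "map snd xs" "map snd ys"] sorted_sort_id[of "map snd ys"]
    by simp
  then have len: "length xs = length ys" by (rule map_eq_imp_length_eq)
  have fst_eq: "sum_list (map fst xs) = sum_list (map fst ys)"
    using m(3) unfolding xs(3) ys(3) by (metis lookup_weight_monomial_of_list(1))
  let ?A = "{0..<length xs}"
  have prod: "(prod_list (map poly_var zs) :: (nat \<times> nat \<Rightarrow>\<^sub>0 nat) \<Rightarrow>\<^sub>0 'k) = (\<Prod>i\<in>?A. poly_var (fst (zs ! i), snd (xs ! i)))"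
    if "length zs = length xs" "map snd zs = map snd xs" for zs :: "(nat \<times> nat) list"
  proof -
    have "zs ! i = (fst (zs ! i), snd (xs ! i))" if "i < length xs" for i
      using that \<open>length zs = length xs\<close> \<open>map snd zs = map snd xs\<close> by (metis nth_map prod.collapse)
    then have "map poly_var zs ! i = poly_var (fst (zs ! i), snd (xs ! i))" if "i < length xs" for i
      using that \<open>length zs = length xs\<close> by (metis nth_map)
    then show ?thesis
      unfolding prod.list_conv_set_nth by (intro prod.cong) (simp_all add: that(1))
  qed
  have mem: "xs ! i \<in> ?V" "ys ! i \<in> ?V" if "i < length xs" for i
    using that len nth_mem[of i xs] nth_mem[of i ys] xs(1) ys(1) m(1,2) by auto
  have "(\<Prod>i\<in>?A. poly_var (fst (xs ! i), snd (xs ! i))) - (\<Prod>i\<in>?A. poly_var (fst (ys ! i), snd (xs ! i))) \<in> J"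
  proof (rule prod_exchange_mem[OF J exchange])
    show "(\<Sum>i\<in>?A. fst (xs ! i)) = (\<Sum>i\<in>?A. fst (ys ! i))"
      using fst_eq len by (simp add: sum_list_sum_nth)
  qed (use mem in \<open>auto simp: mem_Times_iff\<close>)
  then show "Poly_Mapping.single m 1 - Poly_Mapping.single m' 1 \<in> J"
    using prod[of xs] prod[of ys] len snd_eq xs(3) ys(3) by (simp only: single_monomial_of_list)
qed

section \<open>Primes containing the relations between neighbours\<close>

text \<open>
  Only relations between neighbouring values of \<open>s\<close> are assumed. If one interior
  variable of column \<open>k0\<close> is nonzero modulo the prime, then so are its neighbours by
  \<open>quad\<close>, and hence the whole column. In the fraction field of the residue domain the
  column is then a geometric progression, and the minors transport its ratio to every other column:
  with \<open>w j = x\<^bsub>(lo + j, k0)\<^esub>\<close>, every column satisfies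
  \<open>x\<^bsub>(lo + j, k)\<^esub> = x\<^bsub>(lo, k)\<^esub> (w 1 / w 0)\<^sup>j\<close>. A product
  of two variables therefore depends only on the columns and on the sum of the first indices. The
  proof clears denominators and cancels powers of \<open>w 0\<close>.
\<close>

lemma scroll_relation_mem:
  fixes J :: "((nat \<times> 'a \<Rightarrow>\<^sub>0 nat) \<Rightarrow>\<^sub>0 'k::comm_ring_1) set"
  assumes J: "poly_prime ({lo..hi} \<times> K) J"
    and quad: "\<And>s k. lo \<le> s \<Longrightarrow> s + 2 \<le> hi \<Longrightarrow> k \<in> K \<Longrightarrow>
      poly_var (s, k) * poly_var (s + 2, k) - poly_var (s + 1, k) * poly_var (s + 1, k) \<in> J"
    and minor: "\<And>s k k'. lo \<le> s \<Longrightarrow> s + 1 \<le> hi \<Longrightarrow> k \<in> K \<Longrightarrow> k' \<in> K \<Longrightarrow>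
      poly_var (s, k) * poly_var (s + 1, k') - poly_var (s + 1, k) * poly_var (s, k') \<in> J"
    and s0: "lo < s0" "s0 < hi" "k0 \<in> K" "poly_var (s0, k0) \<notin> J"
    and st: "s \<in> {lo..hi}" "s' \<in> {lo..hi}" "u \<in> {lo..hi}" "u' \<in> {lo..hi}" "s + s' = u + u'"
    and k: "k \<in> K" "k' \<in> K"
  shows "poly_var (s, k) * poly_var (s', k') - poly_var (u, k) * poly_var (u', k') \<in> J"
proof -
  interpret poly_prime "{lo..hi} \<times> K" J by (fact J)
  let ?y = "\<lambda>s k. poly_var (s, k) :: (nat \<times> 'a \<Rightarrow>\<^sub>0 nat) \<Rightarrow>\<^sub>0 'k"
  have C: "?y s k \<in> C" if "lo \<le> s" "s \<le> hi" "k \<in> K" for s k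
    using that by (intro poly_var_in_poly_ring) simp
  \<comment> \<open>the square of the middle variable is congruent to the product of its two neighbours\<close>
  have neighbours: "?y a k0 \<notin> J \<and> ?y (a + 2) k0 \<notin> J"
    if "lo \<le> a" "a + 2 \<le> hi" "?y (a + 1) k0 \<notin> J" for a
  proof (rule ccontr)
    assume *: "\<not> ?thesis"
    have "?y a k0 * ?y (a + 2) k0 \<in> J"
    proof (cases "?y a k0 \<in> J")
      case True
      then show ?thesis
        using mult_mem[OF C[of "a + 2" k0] True] that s0 by (simp add: mult.commute)
    next
      case False
      with * show ?thesis using mult_mem[OF C[of a k0]] that s0 by simp
    qed
    then have "?y (a + 1) k0 * ?y (a + 1) k0 \<in> J"
      using diff_mem[OF _ quad[OF that(1,2) s0(3)]] by fastforce
    then show False using cancel[of "?y (a + 1) k0" "?y (a + 1) k0"] that(3) C[of "a + 1" k0] that s0 by simp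
  qed
  have up: "s0 + d \<le> hi \<Longrightarrow> ?y (s0 + d) k0 \<notin> J" for d
  proof (induction d)
    case (Suc d)
    then show ?case using neighbours[of "s0 + d - 1"] s0 by simp
  qed (use s0 in simp)
  have down: "lo + d \<le> s0 \<Longrightarrow> ?y (s0 - d) k0 \<notin> J" for d
  proof (induction d)
    case (Suc d)
    then show ?case using neighbours[of "s0 - Suc d"] s0
      by (simp add: Suc_diff_Suc)
  qed (use s0 in simp)
  have nonzero: "?y s k0 \<notin> J" if "lo \<le> s" "s \<le> hi" for s
    using up[of "s - s0"] down[of "s0 - s"] that s0 by (cases "s0 \<le> s") auto
  let ?w = "\<lambda>j. ?y (lo + j) k0"
  have wC: "?w j \<in> C" if "lo + j \<le> hi" for j using C[of "lo + j" k0] that s0 by simp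
  \<comment> \<open>the ratio of consecutive terms of column \<open>k0\<close> is constant\<close>
  have w_step: "lo + Suc j \<le> hi \<Longrightarrow> ?w (Suc j) * ?w 0 - ?w j * ?w 1 \<in> J" for j
  proof (induction j)
    case 0
    then show ?case using zero_mem by (simp add: mult.commute)
  next
    case (Suc j)
    have "?w j * (?w (Suc (Suc j)) * ?w 0 - ?w (Suc j) * ?w 1)
        = ?w 0 * (?w j * ?w (Suc (Suc j)) - ?w (Suc j) * ?w (Suc j))
        + ?w (Suc j) * (?w (Suc j) * ?w 0 - ?w j * ?w 1)"
      by (simp add: algebra_simps)
    also have "\<dots> \<in> J"
      using quad[of "lo + j" k0] Suc s0 wC[of 0] wC[of "Suc j"] by (intro add_mem mult_mem) auto
    finally show ?case
      by (rule cancel) (use Suc.prems wC s0 nonzero[of "lo + j"] in \<open>auto intro!: poly_ring_closed C\<close>)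
  qed
  have y_step: "?y (lo + Suc j) k * ?w 0 - ?y (lo + j) k * ?w 1 \<in> J"
    if "lo + Suc j \<le> hi" "k \<in> K" for j k
  proof -
    have "?w j * (?y (lo + Suc j) k * ?w 0 - ?y (lo + j) k * ?w 1)
        = ?y (lo + j) k * (?w (Suc j) * ?w 0 - ?w j * ?w 1)
        - ?w 0 * (?y (lo + j) k * ?w (Suc j) - ?y (lo + Suc j) k * ?w j)"
      by (simp add: algebra_simps)
    also have "\<dots> \<in> J"
      using minor[of "lo + j" k k0] w_step[of j] that s0 wC[of 0] C
      by (simp add: diff_mem mult_mem)
    finally show ?thesis
      by (rule cancel) (use that wC s0 nonzero[of "lo + j"] in \<open>auto intro!: poly_ring_closed C\<close>)
  qed
  have y_power: "lo + j \<le> hi \<Longrightarrow> k \<in> K \<Longrightarrow> ?y (lo + j) k * ?w 0 ^ j - ?y lo k * ?w 1 ^ j \<in> J" for j k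
  proof (induction j)
    case 0
    then show ?case using zero_mem by simp
  next
    case (Suc j)
    have "?y (lo + Suc j) k * ?w 0 ^ Suc j - ?y lo k * ?w 1 ^ Suc j
        = ?w 0 ^ j * (?y (lo + Suc j) k * ?w 0 - ?y (lo + j) k * ?w 1)
        + ?w 1 * (?y (lo + j) k * ?w 0 ^ j - ?y lo k * ?w 1 ^ j)"
      by (simp add: algebra_simps)
    also have "\<dots> \<in> J"
      using Suc y_step[of j k] wC[of 0] wC[of 1] s0
      by (intro add_mem mult_mem poly_ring_power_closed) auto
    finally show ?case .
  qed
  have prod_power: "?w 0 ^ (i + j) * (?y (lo + i) k * ?y (lo + j) k') - ?y lo k * ?y lo k' * ?w 1 ^ (i + j) \<in> J"
    if "lo + i \<le> hi" "lo + j \<le> hi" for i j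
  proof -
    have "?w 0 ^ (i + j) * (?y (lo + i) k * ?y (lo + j) k') - ?y lo k * ?y lo k' * ?w 1 ^ (i + j)
        = (?w 0 ^ j * ?y (lo + j) k') * (?y (lo + i) k * ?w 0 ^ i - ?y lo k * ?w 1 ^ i)
        + (?y lo k * ?w 1 ^ i) * (?y (lo + j) k' * ?w 0 ^ j - ?y lo k' * ?w 1 ^ j)"
      by (simp add: algebra_simps power_add)
    also have "\<dots> \<in> J"
      using that k C wC[of 0] wC[of 1] s0
      by (intro add_mem mult_mem y_power poly_ring_closed poly_ring_power_closed) auto
    finally show ?thesis .
  qed
  define i j i' j' where "i = s - lo" "j = s' - lo" "i' = u - lo" "j' = u' - lo"
  then have eqs: "s = lo + i" "s' = lo + j" "u = lo + i'" "u' = lo + j'" "i + j = i' + j'"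
    using st by auto
  have "?w 0 ^ (i + j) * (?y s k * ?y s' k' - ?y u k * ?y u' k')
      = (?w 0 ^ (i + j) * (?y (lo + i) k * ?y (lo + j) k') - ?y lo k * ?y lo k' * ?w 1 ^ (i + j))
      - (?w 0 ^ (i' + j') * (?y (lo + i') k * ?y (lo + j') k') - ?y lo k * ?y lo k' * ?w 1 ^ (i' + j'))"
    unfolding eqs(1-4) eqs(5)[symmetric] by (simp add: algebra_simps)
  also have "\<dots> \<in> J" using st eqs by (intro diff_mem prod_power) auto
  finally show ?thesis
    by (rule cancel) (use st k power_not_mem[of "?w 0" "i + j"] wC[of 0] nonzero[of lo] s0 in
      \<open>auto intro!: poly_ring_closed poly_ring_power_closed C\<close>)
qed

section \<open>Multi-indices and their keys\<close>

lemma exists_fun_with_sum: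
  fixes lo hi :: "'a \<Rightarrow> nat"
  assumes "finite A" "\<And>i. i \<in> A \<Longrightarrow> lo i \<le> hi i" "sum lo A \<le> s" "s \<le> sum hi A"
  shows "\<exists>c. (\<forall>i\<in>A. lo i \<le> c i \<and> c i \<le> hi i) \<and> sum c A = s"
  using assms
proof (induction A arbitrary: s rule: finite_induct)
  case (insert x F)
  \<comment> \<open>the least value at \<open>x\<close> for which the rest of the sum does not exceed \<open>sum hi F\<close>\<close>
  define v where "v = max (lo x) (s - sum hi F)"
  have "sum lo F \<le> sum hi F" using insert by (intro sum_mono) auto
  moreover have "lo x \<le> hi x" using insert by simp
  ultimately have v: "lo x \<le> v" "v \<le> hi x" "v \<le> s" "sum lo F \<le> s - v" "s - v \<le> sum hi F"
    using insert.prems(2,3) insert.hyps unfolding v_def by auto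
  obtain c where c: "\<forall>i\<in>F. lo i \<le> c i \<and> c i \<le> hi i" "sum c F = s - v"
    using insert.IH[OF _ v(4,5)] insert.prems(1) by auto
  have "sum (c(x := v)) F = sum c F"
    by (rule sum.cong) (use insert.hyps in auto)
  then show ?case
    using c v insert.hyps by (intro exI[of _ "c(x := v)"]) auto
qed simp

lemma sum_key_upd:
  assumes "i \<in> {1..n-1}"
  shows "fst (key_of n (a(i := x))) + a i = fst (key_of n a) + x"
    "snd (key_of n (a(i := x))) = snd (key_of n a)"
  using sum_fun_upd_add[of "{1..n-1}" i a x] assms by (auto simp: key_of_def)

lemma key_upd_last: "n \<ge> 1 \<Longrightarrow> key_of n (a(n := x)) = (fst (key_of n a), x)"
  by (auto simp: key_of_def intro!: sum.cong)

lemma keys_of_sw: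
  assumes "i \<in> {1..n}"
  shows "fst (key_of n (sw i a b)) + fst (key_of n (sw i b a)) = fst (key_of n a) + fst (key_of n b)"
    and "snd (key_of n (sw i a b)) = (if i = n then snd (key_of n b) else snd (key_of n a))"
proof -
  have n: "n \<ge> 1" and i: "i = n \<or> i \<in> {1..n-1}" using assms by auto
  show "fst (key_of n (sw i a b)) + fst (key_of n (sw i b a)) = fst (key_of n a) + fst (key_of n b)"
    using i sum_key_upd(1)[of i n a "b i"] sum_key_upd(1)[of i n b "a i"]
    by (auto simp: sw_def key_upd_last[OF n])
  show "snd (key_of n (sw i a b)) = (if i = n then snd (key_of n b) else snd (key_of n a))"
    by (auto simp: sw_def key_of_def)
qed

lemma hdist_sw: "hdist n (sw i a b) (sw i b a) = hdist n a b"
  unfolding hdist_def by (rule arg_cong[where f = card]) (auto simp: sw_def)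

lemma index_set_upd:
  "a \<in> index_set n r \<Longrightarrow> i \<in> {1..n} \<Longrightarrow> 1 \<le> x \<Longrightarrow> x \<le> r i \<Longrightarrow> a(i := x) \<in> index_set n r"
  by (auto simp: index_set_def PiE_iff extensional_def)

lemma index_set_bounds: "a \<in> index_set n r \<Longrightarrow> i \<in> {1..n} \<Longrightarrow> 1 \<le> a i \<and> a i \<le> r i"
  by (auto simp: index_set_def)

locale index_box =
  fixes n :: nat and r :: "nat \<Rightarrow> nat"
  assumes n: "n \<ge> 4" and r: "i \<in> {1..n} \<Longrightarrow> r i \<ge> 2"
begin

abbreviation top_sum where "top_sum \<equiv> \<Sum>i=1..n-1. r i"

lemma r_bounds: "i \<in> {1..n-1} \<Longrightarrow> 2 \<le> r i" "2 \<le> r n"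
  using r n by auto

text \<open>
  Prescribing bounds \<open>lo\<close> and \<open>hi\<close> on the components leaves room for the
  modifications of the tuple by which the generators below are built.
\<close>

lemma exists_index:
  assumes "\<And>i. i \<in> {1..n-1} \<Longrightarrow> 1 \<le> lo i \<and> lo i \<le> hi i \<and> hi i \<le> r i"
    and "(\<Sum>i=1..n-1. lo i) \<le> s" "s \<le> (\<Sum>i=1..n-1. hi i)" "k \<in> {1..r n}"
  obtains a where "a \<in> index_set n r" "key_of n a = (s, k)"
    "\<And>i. i \<in> {1..n-1} \<Longrightarrow> lo i \<le> a i \<and> a i \<le> hi i"
proof -
  obtain c where c: "\<forall>i\<in>{1..n-1}. lo i \<le> c i \<and> c i \<le> hi i" "(\<Sum>i=1..n-1. c i) = s"
    using exists_fun_with_sum[of "{1..n-1}" lo hi s] assms by auto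
  define a where "a i = (if i \<in> {1..n-1} then c i else if i = n then k else undefined)" for i
  have "(\<Sum>i=1..n-1. a i) = s" unfolding c(2)[symmetric] by (rule sum.cong) (auto simp: a_def)
  moreover have "a n = k" using n by (auto simp: a_def)
  ultimately have "key_of n a = (s, k)" by (simp add: key_of_def)
  moreover have "a \<in> index_set n r"
    unfolding index_set_def PiE_iff extensional_def
  proof (intro conjI ballI CollectI allI impI)
    fix i assume "i \<in> {1..n}"
    show "a i \<in> {1..r i}"
    proof (cases "i \<in> {1..n-1}")
      case True
      then show ?thesis using assms(1)[OF True] bspec[OF c(1) True] by (auto simp: a_def)
    next
      case False
      then have "i = n" using \<open>i \<in> {1..n}\<close> by auto
      have "a i = k" using False n \<open>i = n\<close> by (auto simp: a_def)
      then show ?thesis using assms(4) \<open>i = n\<close> by simp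
    qed
  next
    fix i assume "i \<notin> {1..n}"
    then show "a i = undefined" using n by (auto simp: a_def)
  qed
  ultimately show thesis using c(1) by (intro that) (auto simp: a_def)
qed

lemma key_image: "key_of n ` index_set n r = {n-1..top_sum} \<times> {1..r n}"
proof
  show "key_of n ` index_set n r \<subseteq> {n-1..top_sum} \<times> {1..r n}"
  proof (rule image_subsetI)
    fix a assume a: "a \<in> index_set n r"
    have bounds: "1 \<le> a i" "a i \<le> r i" if "i \<in> {1..n-1}" for i
      using index_set_bounds[OF a, of i] that by auto
    have "(\<Sum>i=1..n-1. 1) \<le> (\<Sum>i=1..n-1. a i)" by (intro sum_mono bounds)
    moreover have "(\<Sum>i=1..n-1. a i) \<le> top_sum" by (intro sum_mono bounds)
    ultimately show "key_of n a \<in> {n-1..top_sum} \<times> {1..r n}"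
      using index_set_bounds[OF a, of n] n by (simp add: key_of_def)
  qed
  show "{n-1..top_sum} \<times> {1..r n} \<subseteq> key_of n ` index_set n r"
  proof clarify
    fix s k assume sk: "s \<in> {n-1..top_sum}" "k \<in> {1..r n}"
    obtain a where "a \<in> index_set n r" "key_of n a = (s, k)"
    proof (rule exists_index[of "\<lambda>_. 1" r s k])
      fix i assume "i \<in> {1..n-1}"
      then show "1 \<le> (1::nat) \<and> 1 \<le> r i \<and> r i \<le> r i" using r_bounds(1)[of i] by simp
    qed (use sk in auto)
    then show "(s, k) \<in> key_of n ` index_set n r" by (metis imageI)
  qed
qed

lemma idx_ring_eq: "idx_ring n r = poly_ring ({n-1..top_sum} \<times> {1..r n})"
  by (simp add: idx_ring_def key_image)

lemma key_bounds:
  assumes "a \<in> index_set n r"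
  shows "fst (key_of n a) \<in> {n-1..top_sum}" "snd (key_of n a) \<in> {1..r n}"
  using key_image assms by (metis imageI mem_Times_iff)+

lemma prefix_ones_iff:
  assumes "a \<in> index_set n r"
  shows "(\<forall>i\<in>{1..n-1}. a i = 1) \<longleftrightarrow> fst (key_of n a) = n - 1"
proof
  assume "fst (key_of n a) = n - 1"
  then have eq: "(\<Sum>i=1..n-1. 1) = (\<Sum>i=1..n-1. a i)" by (simp add: key_of_def)
  show "\<forall>i\<in>{1..n-1}. a i = 1"
  proof
    fix i assume "i \<in> {1..n-1}"
    then have "1 = a i"
      by (intro sum_mono_inv[OF eq]) (use index_set_bounds[OF assms] in auto)
    then show "a i = 1" by simp
  qed
qed (simp add: key_of_def)

lemma prefix_top_iff:
  assumes "a \<in> index_set n r"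
  shows "(\<forall>i\<in>{1..n-1}. a i = r i) \<longleftrightarrow> fst (key_of n a) = top_sum"
proof
  assume "fst (key_of n a) = top_sum"
  then have eq: "(\<Sum>i=1..n-1. a i) = (\<Sum>i=1..n-1. r i)" by (simp add: key_of_def)
  show "\<forall>i\<in>{1..n-1}. a i = r i"
  proof
    fix i assume "i \<in> {1..n-1}"
    then show "a i = r i"
      by (intro sum_mono_inv[OF eq]) (use index_set_bounds[OF assms] in auto)
  qed
qed (simp add: key_of_def)

lemma top_sum_ge: "n + 2 \<le> top_sum"
proof -
  have "(\<Sum>i=1..n-1. 2) \<le> top_sum" using r by (intro sum_mono) auto
  then show ?thesis using n by simp
qed

text \<open>
  The keys of the variables generating \<open>P_ideal\<close>: a prefix is constantly \<open>1\<close>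
  or equal to \<open>r\<close> exactly if its sum is extreme.
\<close>

definition inner_keys where "inner_keys = {n-1<..<top_sum} \<times> {1..r n}"

lemma P_ideal_eq: "(P_ideal n r :: 'k::field pol set) = Idl\<^bsub>idx_ring n r\<^esub> (poly_var ` inner_keys)"
proof -
  have inner: "key_of n a \<in> inner_keys \<longleftrightarrow>
      \<not> (\<forall>i\<in>{1..n-1}. a i = 1) \<and> \<not> (\<forall>i\<in>{1..n-1}. a i = r i)" if "a \<in> index_set n r" for a
    using prefix_ones_iff[OF that] prefix_top_iff[OF that] key_bounds[OF that]
    unfolding inner_keys_def mem_Times_iff by fastforce
  have "inner_keys \<subseteq> key_of n ` index_set n r"
    unfolding key_image inner_keys_def by auto
  then have "inner_keys = key_of n ` {a \<in> index_set n r.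
      \<not> (\<forall>i\<in>{1..n-1}. a i = 1) \<and> \<not> (\<forall>i\<in>{1..n-1}. a i = r i)}"
    using inner by blast
  then have "{xvar n a :: 'k pol | a. a \<in> index_set n r \<and> \<not> (\<forall>i\<in>{1..n-1}. a i = 1) \<and> \<not> (\<forall>i\<in>{1..n-1}. a i = r i)}
      = poly_var ` inner_keys"
    by (auto simp: xvar_def image_image)
  then show ?thesis unfolding P_ideal_def by simp
qed

text \<open>
  Two tuples with extreme prefixes differ in at most one position (same extreme) or in at least
  \<open>n - 1 \<ge> 3\<close> positions (opposite extremes, which disagree everywhere because
  \<open>r i \<ge> 2\<close>). This is where \<open>n \<ge> 4\<close> enters.
\<close>

lemma key_inner_if_hdist_2:
  assumes "a \<in> index_set n r" "b \<in> index_set n r" "hdist n a b = 2"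
  shows "key_of n a \<in> inner_keys \<or> key_of n b \<in> inner_keys"
proof (rule ccontr)
  assume *: "\<not> ?thesis"
  have extreme: "(\<forall>i\<in>{1..n-1}. c i = 1) \<or> (\<forall>i\<in>{1..n-1}. c i = r i)"
    if "c \<in> index_set n r" "key_of n c \<notin> inner_keys" for c
    using that(2) prefix_ones_iff[OF that(1)] prefix_top_iff[OF that(1)] key_bounds[OF that(1)]
    unfolding inner_keys_def mem_Times_iff by fastforce
  let ?D = "{i \<in> {1..n}. a i \<noteq> b i}"
  consider "\<forall>i\<in>{1..n-1}. a i = b i" | "\<forall>i\<in>{1..n-1}. a i \<noteq> b i"
  proof -
    have "r i \<noteq> 1" if "i \<in> {1..n-1}" for i using r_bounds(1)[OF that] by simp
    then show thesis
      using extreme[OF assms(1)] extreme[OF assms(2)] * that by fastforce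
  qed
  then show False
  proof cases
    case 1
    have "i = n" if "i \<in> ?D" for i
    proof (rule ccontr)
      assume "i \<noteq> n"
      then have "i \<in> {1..n-1}" using that by auto
      then show False using 1 that by simp
    qed
    then have "?D \<subseteq> {n}" by blast
    then have "card ?D \<le> card {n}" by (rule card_mono[rotated]) simp
    then show False using assms(3) by (simp add: hdist_def)
  next
    case 2
    then have "{1..n-1} \<subseteq> ?D" by auto
    then have "card {1..n-1} \<le> card ?D" by (rule card_mono[rotated]) simp
    then show False using assms(3) n by (simp add: hdist_def)
  qed
qed

section \<open>Relations in the binomial ideals\<close>

lemma fgen_eq: "fgen n i a b = poly_var (key_of n a) * poly_var (key_of n b)
    - poly_var (key_of n (sw i a b)) * poly_var (key_of n (sw i b a))"
  by (simp add: fgen_def xvar_def)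

lemma fgen_mem_I:
  assumes "t \<in> {1..n}" "a \<in> index_set n r" "b \<in> index_set n r" "hdist n a b = 2"
  shows "(fgen n 1 a b :: 'k::field pol) \<in> I_ideal n r t"
proof -
  interpret R: cring "idx_ring n r :: 'k pol ring" unfolding idx_ring_def by (rule poly_ring_cring)
  let ?G = "{fgen n i a b :: 'k pol | i a b. a \<in> index_set n r \<and> b \<in> index_set n r \<and> hdist n a b = 2 \<and> i \<in> {1..t}}"
  have "?G \<subseteq> carrier (idx_ring n r)" using fgen_in_carrier assms(1) by fastforce
  then have "?G \<subseteq> I_ideal n r t" unfolding I_ideal_def by (rule R.genideal_self)
  moreover have "fgen n 1 a b \<in> ?G" using assms by (intro CollectI exI[of _ 1] exI[of _ a] exI[of _ b]) auto
  ultimately show ?thesis by (rule subsetD)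
qed

lemma fgen_mem_I_tilde:
  assumes "t \<in> {1..n}" "a \<in> index_set n r" "b \<in> index_set n r"
  shows "(fgen n 1 a b :: 'k::field pol) \<in> I_tilde n r t"
proof -
  interpret R: cring "idx_ring n r :: 'k pol ring" unfolding idx_ring_def by (rule poly_ring_cring)
  let ?G = "{fgen n i a b :: 'k pol | i a b. a \<in> index_set n r \<and> b \<in> index_set n r \<and> i \<in> {1..t}}"
  have "?G \<subseteq> carrier (idx_ring n r)" using fgen_in_carrier assms(1) by fastforce
  then have "?G \<subseteq> I_tilde n r t" unfolding I_tilde_def by (rule R.genideal_self)
  moreover have "fgen n 1 a b \<in> ?G" using assms by (intro CollectI exI[of _ 1] exI[of _ a] exI[of _ b]) auto
  ultimately show ?thesis by (rule subsetD)
qed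

lemma ideal_I_tilde:
  assumes "t \<in> {1..n}"
  shows "poly_ideal ({n-1..top_sum} \<times> {1..r n}) (I_tilde n r t :: 'k::field pol set)"
proof -
  interpret R: cring "idx_ring n r :: 'k pol ring" unfolding idx_ring_def by (rule poly_ring_cring)
  have "ideal (I_tilde n r t :: 'k pol set) (idx_ring n r)"
    unfolding I_tilde_def
    by (rule R.genideal_ideal) (use fgen_in_carrier assms in fastforce)
  then show ?thesis unfolding idx_ring_eq by (rule poly_ideal.intro)
qed

lemma I_ideal_subset:
  assumes "ideal q (idx_ring n r :: 'k::field pol ring)"
    and "\<And>i a b. a \<in> index_set n r \<Longrightarrow> b \<in> index_set n r \<Longrightarrow> hdist n a b = 2 \<Longrightarrow> i \<in> {1..t} \<Longrightarrow>
      fgen n i a b \<in> q"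
  shows "I_ideal n r t \<subseteq> q"
proof -
  interpret R: cring "idx_ring n r :: 'k pol ring" unfolding idx_ring_def by (rule poly_ring_cring)
  show ?thesis unfolding I_ideal_def by (rule R.genideal_minimal[OF assms(1)]) (use assms(2) in auto)
qed

lemma I_tilde_subset:
  assumes "ideal q (idx_ring n r :: 'k::field pol ring)"
    and "\<And>i a b. a \<in> index_set n r \<Longrightarrow> b \<in> index_set n r \<Longrightarrow> i \<in> {1..t} \<Longrightarrow> fgen n i a b \<in> q"
  shows "I_tilde n r t \<subseteq> q"
proof -
  interpret R: cring "idx_ring n r :: 'k pol ring" unfolding idx_ring_def by (rule poly_ring_cring)
  show ?thesis unfolding I_tilde_def by (rule R.genideal_minimal[OF assms(1)]) (use assms(2) in auto)
qed

text \<open>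
  Let \<open>b\<close> be \<open>a\<close> with its first two components raised by one. Swapping the
  first component gives two tuples of prefix sum \<open>s + 1\<close>. The bounds \<open>hi\<close>
  leave room for both increments, and every prefix sum up to \<open>top_sum - 2\<close> can be reached.
\<close>

lemma quadric_mem_I:
  assumes t: "t \<in> {1..n}" and s: "n - 1 \<le> s" "s + 2 \<le> top_sum" and k: "k \<in> {1..r n}"
  shows "poly_var (s, k) * poly_var (s + 2, k) - poly_var (s + 1, k) * poly_var (s + 1, k)
    \<in> (I_ideal n r t :: 'k::field pol set)"
proof -
  define hi where "hi = r(1 := r 1 - 1, 2 := r 2 - 1)"
  have idx: "1 \<in> {1..n-1}" "2 \<in> {1..n-1}" "1 \<in> {1..n}" "2 \<in> {1..n}" using n by auto
  have hi_sum: "sum hi {1..n-1} + 2 = top_sum"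
  proof -
    have "(r(1 := r 1 - 1)) 2 = r 2" by simp
    then show ?thesis
      using sum_fun_upd_add[OF finite_atLeastAtMost idx(1), of r "r 1 - 1"] r_bounds(1)[OF idx(1)]
        sum_fun_upd_add[OF finite_atLeastAtMost idx(2), of "r(1 := r 1 - 1)" "r 2 - 1"]
        r_bounds(1)[OF idx(2)] unfolding hi_def by linarith
  qed
  obtain a where a: "a \<in> index_set n r" "key_of n a = (s, k)"
    and a_le: "\<And>i. i \<in> {1..n-1} \<Longrightarrow> 1 \<le> a i \<and> a i \<le> hi i"
  proof (rule exists_index[of "\<lambda>_. 1" hi s k])
    fix i assume "i \<in> {1..n-1}"
    then show "1 \<le> (1::nat) \<and> 1 \<le> hi i \<and> hi i \<le> r i" using r_bounds(1)[of i] by (auto simp: hi_def)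
  qed (use s k hi_sum in auto)
  have lt: "a 1 + 1 \<le> r 1" "a 2 + 1 \<le> r 2"
    using a_le[OF idx(1)] a_le[OF idx(2)] r_bounds(1)[OF idx(1)] r_bounds(1)[OF idx(2)]
    by (auto simp: hi_def)
  define a1 where "a1 = a(1 := a 1 + 1)"
  define a2 where "a2 = a(2 := a 2 + 1)"
  define b where "b = a1(2 := a 2 + 1)"
  have b: "b \<in> index_set n r"
    unfolding b_def a1_def using a(1) idx lt by (intro index_set_upd) auto
  have key: "key_of n a1 = (s + 1, k)" "key_of n a2 = (s + 1, k)"
    using sum_key_upd[OF idx(1), of a "a 1 + 1"] sum_key_upd[OF idx(2), of a "a 2 + 1"] a(2)
    unfolding a1_def a2_def by (auto simp: prod_eq_iff)
  have keyb: "key_of n b = (s + 2, k)"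
    using sum_key_upd[OF idx(2), of a1 "a 2 + 1"] key(1)
    unfolding b_def by (auto simp: prod_eq_iff a1_def)
  have "{i \<in> {1..n}. a i \<noteq> b i} = {1, 2}" using idx by (auto simp: b_def a1_def)
  then have "hdist n a b = 2" by (simp add: hdist_def)
  then have "(fgen n 1 a b :: 'k pol) \<in> I_ideal n r t" using fgen_mem_I[OF t a(1) b] by blast
  moreover have "sw 1 a b = a1" "sw 1 b a = a2"
    by (auto simp: sw_def b_def a1_def a2_def)
  ultimately show ?thesis by (simp add: fgen_eq a(2) key keyb)
qed

text \<open>
  Here \<open>b\<close> is \<open>a\<close> with the first component raised by one and the last
  replaced by \<open>k'\<close>; for \<open>k = k'\<close> the relation is \<open>0\<close>.
\<close>

lemma minor_mem_I:
  assumes t: "t \<in> {1..n}" and s: "n - 1 \<le> s" "s + 1 \<le> top_sum"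
    and k: "k \<in> {1..r n}" "k' \<in> {1..r n}"
  shows "poly_var (s, k) * poly_var (s + 1, k') - poly_var (s + 1, k) * poly_var (s, k')
    \<in> (I_ideal n r t :: 'k::field pol set)"
proof (cases "k = k'")
  case True
  interpret R: cring "idx_ring n r :: 'k pol ring" unfolding idx_ring_def by (rule poly_ring_cring)
  have "ideal (I_ideal n r t :: 'k pol set) (idx_ring n r)"
    unfolding I_ideal_def by (rule R.genideal_ideal) (use fgen_in_carrier t in fastforce)
  then have "0 \<in> (I_ideal n r t :: 'k pol set)"
    unfolding idx_ring_eq ideal_poly_ring_iff by blast
  then show ?thesis using True by (simp add: mult.commute)
next
  case False
  define hi where "hi = r(1 := r 1 - 1)"
  have idx: "1 \<in> {1..n-1}" "1 \<in> {1..n}" "n \<in> {1..n}" "n \<noteq> 1" "n \<ge> 1" using n by auto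
  have hi_sum: "sum hi {1..n-1} + 1 = top_sum"
    using sum_fun_upd_add[OF finite_atLeastAtMost idx(1), of r "r 1 - 1"] r_bounds(1)[OF idx(1)]
    unfolding hi_def by linarith
  obtain a where a: "a \<in> index_set n r" "key_of n a = (s, k)"
    and a_le: "\<And>i. i \<in> {1..n-1} \<Longrightarrow> 1 \<le> a i \<and> a i \<le> hi i"
  proof (rule exists_index[of "\<lambda>_. 1" hi s k])
    fix i assume "i \<in> {1..n-1}"
    then show "1 \<le> (1::nat) \<and> 1 \<le> hi i \<and> hi i \<le> r i" using r_bounds(1)[of i] by (auto simp: hi_def)
  qed (use s k hi_sum in auto)
  have lt: "a 1 + 1 \<le> r 1"
    using a_le[OF idx(1)] r_bounds(1)[OF idx(1)] by (auto simp: hi_def)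
  have an: "a n = k" using a(2) by (simp add: key_of_def)
  define a1 where "a1 = a(1 := a 1 + 1)"
  define a2 where "a2 = a(n := k')"
  define b where "b = a1(n := k')"
  have b: "b \<in> index_set n r"
    unfolding b_def a1_def using a(1) idx lt k by (intro index_set_upd) auto
  have key: "key_of n a1 = (s + 1, k)" "key_of n a2 = (s, k')"
    using sum_key_upd[OF idx(1), of a "a 1 + 1"] key_upd_last[OF idx(5), of a k'] a(2)
    unfolding a1_def a2_def by (auto simp: prod_eq_iff)
  have keyb: "key_of n b = (s + 1, k')"
    using key_upd_last[OF idx(5), of a1 k'] key(1) by (simp add: b_def)
  have "{i \<in> {1..n}. a i \<noteq> b i} = {1, n}" using idx False an by (auto simp: b_def a1_def)
  then have "hdist n a b = 2" using idx(4) by (simp add: hdist_def)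
  then have "(fgen n 1 a b :: 'k pol) \<in> I_ideal n r t" using fgen_mem_I[OF t a(1) b] by blast
  moreover have "sw 1 a b = a1" "sw 1 b a = a2"
    using idx(4) by (auto simp: sw_def b_def a1_def a2_def)
  ultimately show ?thesis by (simp add: fgen_eq a(2) key keyb)
qed

text \<open>
  A single generator does not suffice: if \<open>r 1\<close> is large, a tuple with prefix sum
  \<open>s\<close> and one with prefix sum \<open>s'\<close> need not have first components differing
  by one. But a unit can be moved in two steps. Raise the first component of \<open>a\<close> and
  lower the second component of \<open>b\<close>; swapping first components before or after this
  change leads to the same pair of keys, so the relation is a difference of two generators.
\<close>

lemma exchange_mem_I_tilde:
  assumes t: "t \<in> {1..n}" and s: "s \<in> {n-1..<top_sum}" "s' \<in> {n-1<..top_sum}"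
    and k: "k \<in> {1..r n}" "k' \<in> {1..r n}"
  shows "poly_var (s, k) * poly_var (s', k') - poly_var (Suc s, k) * poly_var (s' - 1, k')
    \<in> (I_tilde n r t :: 'k::field pol set)"
proof -
  interpret poly_ideal "{n-1..top_sum} \<times> {1..r n}" "I_tilde n r t :: 'k pol set"
    by (rule ideal_I_tilde[OF t])
  define hi where "hi = r(1 := r 1 - 1)"
  \<comment> \<open>so that the second component of \<open>b\<close> can be lowered, as \<open>hi\<close> lets the first one of \<open>a\<close> be raised\<close>
  define lo where "lo = (\<lambda>_::nat. 1::nat)(2 := 2)"
  have idx: "1 \<in> {1..n-1}" "2 \<in> {1..n-1}" "1 \<in> {1..n}" "2 \<in> {1..n}" using n by auto
  have hi: "sum hi {1..n-1} + 1 = top_sum"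
    using sum_fun_upd_add[OF finite_atLeastAtMost idx(1), of r "r 1 - 1"] r_bounds(1)[OF idx(1)]
    unfolding hi_def by linarith
  have lo: "sum lo {1..n-1} = n"
    using sum_fun_upd_add[OF finite_atLeastAtMost idx(2), of "\<lambda>_. 1::nat" 2] n unfolding lo_def by simp
  obtain a where a: "a \<in> index_set n r" "key_of n a = (s, k)"
    and a_le: "\<And>i. i \<in> {1..n-1} \<Longrightarrow> 1 \<le> a i \<and> a i \<le> hi i"
  proof (rule exists_index[of "\<lambda>_. 1" hi s k])
    fix i assume "i \<in> {1..n-1}"
    then show "1 \<le> (1::nat) \<and> 1 \<le> hi i \<and> hi i \<le> r i" using r_bounds(1)[of i] by (auto simp: hi_def)
  qed (use s k hi in auto)
  obtain b where b: "b \<in> index_set n r" "key_of n b = (s', k')"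
    and b_ge: "\<And>i. i \<in> {1..n-1} \<Longrightarrow> lo i \<le> b i \<and> b i \<le> r i"
  proof (rule exists_index[of lo r s' k'])
    fix i assume "i \<in> {1..n-1}"
    then show "1 \<le> lo i \<and> lo i \<le> r i \<and> r i \<le> r i" using r_bounds(1)[of i] by (auto simp: lo_def)
  qed (use s k lo in auto)
  have lt: "a 1 + 1 \<le> r 1" "2 \<le> b 2" "b 2 \<le> r 2"
    using a_le[OF idx(1)] r_bounds(1)[OF idx(1)] b_ge[OF idx(2)] by (auto simp: hi_def lo_def)
  define a' where "a' = a(1 := a 1 + 1)"
  define b' where "b' = b(2 := b 2 - 1)"
  have mem: "a' \<in> index_set n r" "b' \<in> index_set n r"
    unfolding a'_def b'_def using a(1) b(1) idx lt by (auto intro!: index_set_upd)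
  have key: "key_of n a' = (Suc s, k)" "key_of n b' = (s' - 1, k')"
    using sum_key_upd[OF idx(1), of a "a 1 + 1"] sum_key_upd[OF idx(2), of b "b 2 - 1"] a(2) b(2) lt(2)
    unfolding a'_def b'_def by (auto simp: prod_eq_iff)
  have sw1: "sw 1 a' b' = sw 1 a b" by (auto simp: sw_def a'_def b'_def)
  have sw2: "key_of n (sw 1 b' a') = key_of n (sw 1 b a)"
    using sum_key_upd[OF idx(1), of b "a 1"] sum_key_upd[OF idx(1), of b' "a 1 + 1"]
      sum_key_upd[OF idx(2), of b "b 2 - 1"] lt(2)
    by (auto simp: prod_eq_iff sw_def a'_def b'_def)
  have "(fgen n 1 a b :: 'k pol) - fgen n 1 a' b' \<in> I_tilde n r t"
    by (intro diff_mem fgen_mem_I_tilde t a b mem)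
  then show ?thesis unfolding fgen_eq a(2) b(2) key sw1 sw2 by simp
qed

section \<open>The two primes\<close>

text \<open>
  A swap preserves the sum of the two first indices and, up to order, the two second indices; these
  determine the weight of a product of two variables.
\<close>

lemma monomial_map_fgen:
  assumes "i \<in> {1..n}"
  shows "monomial_map weight (fgen n i a b :: 'k::field pol) = 0"
proof -
  have uv: "monomial_map weight (poly_var u * poly_var v :: 'k pol) =
      Poly_Mapping.single (Poly_Mapping.single 0 (fst u + fst v)
        + (Poly_Mapping.single (Suc (snd u)) 1 + Poly_Mapping.single (Suc (snd v)) 1)) 1" for u v
    by (simp add: poly_var_def mult_single weight_add weight_single[simplified] single_add ac_simps)
  have "monomial_map weight (fgen n i a b :: 'k pol) + monomial_map weight (poly_var (key_of n (sw i a b)) *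
      poly_var (key_of n (sw i b a))) = monomial_map weight (poly_var (key_of n a) * poly_var (key_of n b))"
    by (simp add: fgen_eq monomial_map_add[symmetric])
  then show ?thesis
    unfolding uv using keys_of_sw[OF assms, of a b] keys_of_sw(2)[OF assms, of b a]
    by (simp add: add.commute split: if_splits)
qed

lemma I_tilde_eq_kernel:
  assumes "t \<in> {1..n}"
  shows "(I_tilde n r t :: 'k::field pol set) = {p \<in> carrier (idx_ring n r). monomial_map weight p = 0}"
  unfolding idx_ring_eq
proof (rule eq_toric_kernel[OF ideal_I_tilde[OF assms]])
  let ?K = "{p \<in> carrier (idx_ring n r). monomial_map weight p = (0 :: (nat \<Rightarrow>\<^sub>0 nat) \<Rightarrow>\<^sub>0 'k)}"
  have "primeideal ?K (idx_ring n r)"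
    unfolding idx_ring_def by (rule primeideal_kernel_monomial_map) (rule weight_add)
  then have "ideal ?K (idx_ring n r)" unfolding idx_ring_def primeideal_poly_ring_iff by blast
  then have "I_tilde n r t \<subseteq> ?K"
    by (rule I_tilde_subset) (use assms in \<open>auto simp: fgen_in_carrier monomial_map_fgen\<close>)
  then show "monomial_map weight p = 0" if "p \<in> I_tilde n r t" for p :: "'k pol"
    using that by blast
qed (rule exchange_mem_I_tilde[OF assms])

lemma primeideal_I_tilde:
  assumes "t \<in> {1..n}"
  shows "primeideal (I_tilde n r t) (idx_ring n r :: 'k::field pol ring)"
  unfolding I_tilde_eq_kernel[OF assms] idx_ring_eq
  by (rule primeideal_kernel_monomial_map) (rule weight_add)

lemma primeideal_P: "primeideal (P_ideal n r) (idx_ring n r :: 'k::field pol ring)"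
  unfolding P_ideal_eq idx_ring_eq by (rule primeideal_monomial_ideal) (auto simp: inner_keys_def)

lemma poly_var_mem_P_iff:
  "v \<in> {n-1..top_sum} \<times> {1..r n} \<Longrightarrow> (poly_var v :: 'k::field pol) \<in> P_ideal n r \<longleftrightarrow> v \<in> inner_keys"
  unfolding P_ideal_eq idx_ring_eq
  by (subst monomial_ideal_eq) (auto simp: inner_keys_def poly_var_def carrier_poly_ring_iff)

text \<open>
  If \<open>q\<close> misses a generator of \<open>P_ideal\<close>, some interior variable is nonzero
  modulo \<open>q\<close>, and the relations of the scroll follow from those in \<open>I_ideal\<close>.
  Every generator of \<open>I_tilde\<close> is such a relation; for \<open>i = n\<close> the swap
  exchanges the second indices, which amounts to exchanging the first ones.
\<close>

lemma prime_over_I: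
  assumes t: "t \<in> {1..n}" and q: "primeideal q (idx_ring n r :: 'k::field pol ring)"
    and I: "I_ideal n r t \<subseteq> q" and P: "\<not> P_ideal n r \<subseteq> q"
  shows "I_tilde n r t \<subseteq> q"
proof -
  interpret R: cring "idx_ring n r :: 'k pol ring" unfolding idx_ring_def by (rule poly_ring_cring)
  have ideal: "ideal q (idx_ring n r)" using q unfolding idx_ring_eq primeideal_poly_ring_iff by blast
  have prime: "poly_prime ({n-1..top_sum} \<times> {1..r n}) q"
    using q ideal unfolding idx_ring_eq
    by (intro poly_prime.intro poly_ideal.intro poly_prime_axioms.intro)
  have "\<not> poly_var ` inner_keys \<subseteq> q"
    using R.genideal_minimal[OF ideal, of "poly_var ` inner_keys"] P unfolding P_ideal_eq by blast
  then obtain s0 k0 where s0: "(s0, k0) \<in> inner_keys" "poly_var (s0, k0) \<notin> q" by auto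
  have rel: "poly_var (s, k) * poly_var (s', k') - poly_var (u, k) * poly_var (u', k') \<in> q"
    if "s \<in> {n-1..top_sum}" "s' \<in> {n-1..top_sum}" "u \<in> {n-1..top_sum}" "u' \<in> {n-1..top_sum}"
      "s + s' = u + u'" "k \<in> {1..r n}" "k' \<in> {1..r n}" for s s' u u' k k'
  proof (rule scroll_relation_mem[OF prime _ _ _ _ _ s0(2) that])
    show "n - 1 < s0" "s0 < top_sum" "k0 \<in> {1..r n}" using s0(1) by (auto simp: inner_keys_def)
  qed (use I quadric_mem_I[OF t] minor_mem_I[OF t] in blast)+
  show ?thesis
  proof (rule I_tilde_subset[OF ideal])
    fix i a b assume ab: "a \<in> index_set n r" "b \<in> index_set n r" and "i \<in> {1..t}"
    then have i: "i \<in> {1..n}" using t by auto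
    let ?c = "sw i a b" and ?d = "sw i b a"
    have cd: "?c \<in> index_set n r" "?d \<in> index_set n r" using ab i by (auto intro: sw_in_index_set)
    note keys = keys_of_sw[OF i, of a b] keys_of_sw(2)[OF i, of b a]
    show "fgen n i a b \<in> q"
    proof (cases "i = n")
      case False
      have "poly_var (fst (key_of n a), snd (key_of n a)) * poly_var (fst (key_of n b), snd (key_of n b))
          - poly_var (fst (key_of n ?c), snd (key_of n a)) * poly_var (fst (key_of n ?d), snd (key_of n b)) \<in> q"
        using keys(1) by (intro rel key_bounds ab cd) simp
      moreover have "key_of n ?c = (fst (key_of n ?c), snd (key_of n a))"
        "key_of n ?d = (fst (key_of n ?d), snd (key_of n b))"
        using keys False by (auto simp: prod_eq_iff)
      ultimately show ?thesis unfolding fgen_eq by (metis prod.collapse)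
    next
      case True
      have "poly_var (fst (key_of n a), snd (key_of n a)) * poly_var (fst (key_of n b), snd (key_of n b))
          - poly_var (fst (key_of n ?d), snd (key_of n a)) * poly_var (fst (key_of n ?c), snd (key_of n b)) \<in> q"
        using keys(1) by (intro rel key_bounds ab cd) simp
      moreover have "key_of n ?c = (fst (key_of n ?c), snd (key_of n b))"
        "key_of n ?d = (fst (key_of n ?d), snd (key_of n a))"
        using keys True by (auto simp: prod_eq_iff)
      ultimately show ?thesis unfolding fgen_eq by (metis prod.collapse mult.commute)
    qed
  qed
qed

lemma I_subset_I_tilde:
  assumes "t \<in> {1..n}"
  shows "(I_ideal n r t :: 'k::field pol set) \<subseteq> I_tilde n r t"
proof -
  have "ideal (I_tilde n r t :: 'k pol set) (idx_ring n r)"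
    using ideal_I_tilde[OF assms] unfolding idx_ring_eq poly_ideal_def .
  moreover have "fgen n i a b \<in> {p \<in> carrier (idx_ring n r). monomial_map weight (p :: 'k pol) = 0}"
    if "a \<in> index_set n r" "b \<in> index_set n r" "i \<in> {1..t}" for i a b
    using that assms by (auto simp: fgen_in_carrier monomial_map_fgen)
  ultimately show ?thesis
    unfolding I_tilde_eq_kernel[OF assms] by (intro I_ideal_subset)
qed

lemma I_subset_P:
  assumes "t \<in> {1..n}"
  shows "(I_ideal n r t :: 'k::field pol set) \<subseteq> P_ideal n r"
proof (rule I_ideal_subset)
  show ideal: "ideal (P_ideal n r) (idx_ring n r :: 'k pol ring)"
    using primeideal_P unfolding idx_ring_eq primeideal_poly_ring_iff by blast
  interpret poly_ideal "{n-1..top_sum} \<times> {1..r n}" "P_ideal n r :: 'k pol set"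
    using ideal unfolding idx_ring_eq by (rule poly_ideal.intro)
  have prod_mem: "(poly_var (key_of n a) * poly_var (key_of n b) :: 'k pol) \<in> P_ideal n r"
    if ab: "a \<in> index_set n r" "b \<in> index_set n r" "hdist n a b = 2" for a b
  proof -
    have keys: "key_of n a \<in> {n-1..top_sum} \<times> {1..r n}" "key_of n b \<in> {n-1..top_sum} \<times> {1..r n}"
      using ab(1,2) key_image by blast+
    from key_inner_if_hdist_2[OF ab] show ?thesis
    proof
      assume "key_of n a \<in> inner_keys"
      then have "(poly_var (key_of n b) * poly_var (key_of n a) :: 'k pol) \<in> P_ideal n r"
        using keys by (intro mult_mem poly_var_in_poly_ring) (simp_all add: poly_var_mem_P_iff)
      then show ?thesis by (simp add: mult.commute)
    next
      assume "key_of n b \<in> inner_keys"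
      then show ?thesis
        using keys by (intro mult_mem poly_var_in_poly_ring) (simp_all add: poly_var_mem_P_iff)
    qed
  qed
  fix i a b assume ab: "a \<in> index_set n r" "b \<in> index_set n r" "hdist n a b = 2" and "i \<in> {1..t}"
  then have "sw i a b \<in> index_set n r" "sw i b a \<in> index_set n r"
    using assms by (auto intro!: sw_in_index_set)
  then show "(fgen n i a b :: 'k pol) \<in> P_ideal n r"
    unfolding fgen_eq using ab by (intro diff_mem prod_mem) (simp_all add: hdist_sw)
qed

lemma not_P_subset_I_tilde:
  assumes "t \<in> {1..n}"
  shows "\<not> P_ideal n r \<subseteq> (I_tilde n r t :: 'k::field pol set)"
proof
  let ?v = "(n, 1) :: nat \<times> nat"
  have v: "?v \<in> inner_keys" "?v \<in> {n-1..top_sum} \<times> {1..r n}"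
    using top_sum_ge r_bounds(2) n by (auto simp: inner_keys_def)
  assume "P_ideal n r \<subseteq> (I_tilde n r t :: 'k pol set)"
  then have "(poly_var ?v :: 'k pol) \<in> I_tilde n r t" using v poly_var_mem_P_iff by blast
  then have "monomial_map weight (poly_var ?v :: 'k pol) = 0"
    unfolding I_tilde_eq_kernel[OF assms] by blast
  then have "Poly_Mapping.keys (Poly_Mapping.single (weight (Poly_Mapping.single ?v 1)) (1 :: 'k)) = {}"
    by (simp add: poly_var_def)
  then show False by simp
qed

text \<open>
  The exchange applied to the two extreme variables of a column: one product in it lies in
  \<open>P_ideal\<close>, the other consists of variables outside this prime.
\<close>

lemma not_I_tilde_subset_P:
  assumes "t \<in> {1..n}"
  shows "\<not> I_tilde n r t \<subseteq> (P_ideal n r :: 'k::field pol set)"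
proof
  assume sub: "I_tilde n r t \<subseteq> (P_ideal n r :: 'k pol set)"
  interpret poly_ideal "{n-1..top_sum} \<times> {1..r n}" "P_ideal n r :: 'k pol set"
    using primeideal_P unfolding idx_ring_eq primeideal_poly_ring_iff by (intro poly_ideal.intro) blast
  interpret poly_prime "{n-1..top_sum} \<times> {1..r n}" "P_ideal n r :: 'k pol set"
    using primeideal_P unfolding idx_ring_eq
    by (intro poly_prime.intro poly_prime_axioms.intro poly_ideal_axioms)
  have one: "1 \<in> {1..r n}" using r_bounds(2) by auto
  let ?x = "\<lambda>s. poly_var (s, 1) :: 'k pol"
  have "?x (n - 1) * ?x top_sum - ?x (Suc (n - 1)) * ?x (top_sum - 1) \<in> P_ideal n r"
    using top_sum_ge by (intro subsetD[OF sub] exchange_mem_I_tilde[OF assms _ _ one one]) auto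
  moreover have "?x (Suc (n - 1)) * ?x (top_sum - 1) \<in> P_ideal n r"
    using top_sum_ge one n
    by (intro mult_mem poly_var_in_poly_ring) (auto simp: poly_var_mem_P_iff inner_keys_def)
  ultimately have "?x (n - 1) * ?x top_sum \<in> P_ideal n r"
    using add_mem by fastforce
  moreover have "?x (n - 1) \<in> C" "?x top_sum \<in> C"
    using top_sum_ge one by (auto intro!: poly_var_in_poly_ring)
  ultimately have "?x (n - 1) \<in> P_ideal n r \<or> ?x top_sum \<in> P_ideal n r"
    using cancel by blast
  then show False
    using top_sum_ge one by (auto simp: poly_var_mem_P_iff inner_keys_def)
qed

end

theorem theorem5p10:
  fixes n t :: nat and r :: "nat \<Rightarrow> nat"
  assumes "n \<ge> 4"
    and "\<And>i. i \<in> {1..n} \<Longrightarrow> r i \<ge> 2"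
    and "t \<in> {1..n}"
  shows "minimal_primes (idx_ring n r :: 'k::field pol ring) (I_ideal n r t) = {I_tilde n r t, P_ideal n r}
       \<and> (I_tilde n r t :: 'k pol set) \<noteq> P_ideal n r"
proof
  interpret index_box n r by unfold_locales (use assms in auto)
  note t = assms(3)
  show "minimal_primes (idx_ring n r :: 'k::field pol ring) (I_ideal n r t) = {I_tilde n r t, P_ideal n r}"
    using prime_over_I[OF t]
    by (intro minimal_primes_eq_pair primeideal_I_tilde primeideal_P I_subset_I_tilde I_subset_P
        not_I_tilde_subset_P not_P_subset_I_tilde t) blast
  show "(I_tilde n r t :: 'k pol set) \<noteq> P_ideal n r"
    using not_P_subset_I_tilde[OF t] by blast
qed

end
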